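(* Let $n\ge1$, $\alpha=\pi/(2n+1)$, and let $\Gamma$ be the exchange graph of the initial seed $(\mathbf v_0,B_0)$. Then $\Gamma$ has polynomial growth and its polynomial growth rate is equal to $\varphi(2n+1)/2$, where $\varphi$ is Euler's totient function.
   Context: **Exchange matrices.** An exchange matrix is a real skew-symmetric $3\times3$ matrix $B=(b_{ij})$, identified with the quiver on $\{1,2,3\}$ having an arrow $i\to j$ of weight $b_{ij}$ whenever $b_{ij}>0$; it is acyclic if this quiver has no oriented cycle, cyclic otherwise. The mutation $\mu_k(B)=(b'_{ij})$ is given by $b'_{ij}=-b_{ij}$ if $k\in\{i,j\}$ and $b'_{ij}=b_{ij}+(b_{ik}|b_{kj}|+|b_{ik}|b_{kj})/2$ otherwise. **Seeds in $\mathbb E^2$.** Let $V$ be the space of affine functions $f(x)=\langle a,x\rangle+c$ on the Euclidean plane $\mathbb E^2$ with the form $(f,g)=\langle a,a'\rangle$ for $g(x)=\langle a',x\rangle+c'$; for non-constant $f$ put $\Pi_f=\{f<0\}$, $l_f=\{f=0\}$. A geometric realisation of $B$ is a basis $\mathbf v=(v_1,v_2,v_3)$ of $V$ with $(v_i,v_i)=2$, $|(v_i,v_j)|=|b_{ij}|$ for $i\neq j$, and such that, if all $(v_i,v_j)\ne0$, the number of pairs $i<j$ with $(v_i,v_j)>0$ is even if $B$ is acyclic and odd otherwise. A seed is a pair $(\mathbf v,B)$ up to simultaneous permutation of indices. It is represented by the domain $\Pi_{v_1}\cap\Pi_{v_2}\cap\Pi_{v_3}$, a triangle or an infinite region bounded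 by two parallel half-lines and a segment, together with the quiver of $B$, whose vertices are the sides (weights are $2\cos$ of the angle between the corresponding lines). **Mutation.** Given a notion of positive/negative vectors ($v$ negative iff $-v$ positive), $\mu_k(\mathbf v,B)=(\mathbf v',\mu_k(B))$ with $v_k'=-v_k$ and, for $i\ne k$: if $v_k$ is positive, $v_i'=v_i$ when $b_{ik}>0$ and $v_i'=v_i-(v_i,v_k)v_k$ when $b_{ik}<0$; if $v_k$ is negative, $v_i'=v_i$ when $b_{ik}<0$ and $v_i'=v_i-(v_i,v_k)v_k$ when $b_{ik}>0$. The exchange graph of a seed has as vertices all seeds obtained from it by mutations; edges join seeds related by one mutation. **Initial seed.** The initial triangle $\Delta_0$ is an isosceles triangle $XYZ$ with angle $n\alpha$ at $X$ and at $Y$ and angle $\alpha$ at $Z$. The initial seed $(\mathbf v_0,B_0)$ is given by $\Delta_0$ with the quiver having arrows $XY\to XZ$, $XY\to YZ$, $XZ\to YZ$ (source $XY$, sink $YZ$). The belt line $b$ is the line through the feet of the altitudes of $\Delta_0$ on the sides $XY$ and $YZ$. The reference point $u$ lies infinitely far away on $b$, in the direction from the foot on the source to the foot on the sink: $v$ is positive iff all points of $b$ sufficiently far in this direction lie in $\Pi_v$. **Growth.** Let $x_0=(\mathbf v_0,B_0)$, let $d$ be the graph distance on the vertex set of $\Gamma$, and $gr(m)=|\{x: d(x_0,x)\le m\}|$. $\Gamma$ has polynomial growth if $gr(m)=\mathcal O(m^r)$ for some $r\ge0$; the polynomial growth rate is the smallest natural number $r$ with $gr(m)=\mathcal O(m^r)$.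 *)

theory Defs
  imports "HOL-Analysis.Analysis" "HOL-Library.Landau_Symbols" "HOL-Number_Theory.Totient"
begin

section \<open>Exchange matrices\<close>

definition exchange_matrix :: "real ^ 3 ^ 3 \<Rightarrow> bool" where
  "exchange_matrix B \<longleftrightarrow> transpose B = - B"

definition quiver_arrows :: "real ^ 3 ^ 3 \<Rightarrow> (3 \<times> 3) set" where
  "quiver_arrows B = {(i, j). B $ i $ j > 0}"

definition acyclic_matrix :: "real ^ 3 ^ 3 \<Rightarrow> bool" where
  "acyclic_matrix B \<longleftrightarrow> acyclic (quiver_arrows B)"

definition matrix_mutation :: "3 \<Rightarrow> real ^ 3 ^ 3 \<Rightarrow> real ^ 3 ^ 3" where
  "matrix_mutation k B =
     (\<chi> i j. if i = k \<or> j = k then - B $ i $ j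
            else B $ i $ j + (B $ i $ k * \<bar>B $ k $ j\<bar> + \<bar>B $ i $ k\<bar> * B $ k $ j) / 2)"


section \<open>Affine functions and geometric realisations\<close>

text \<open>The pair \<open>(a, c)\<close> stands for the affine function \<open>x \<mapsto> a \<bullet> x + c\<close>; the vector space
  structure on affine functions is the componentwise one of the product type.\<close>

type_synonym affine_fun = "(real ^ 2) \<times> real"

definition aff_eval :: "affine_fun \<Rightarrow> real ^ 2 \<Rightarrow> real" where
  "aff_eval f x = fst f \<bullet> x + snd f"

definition aff_form :: "affine_fun \<Rightarrow> affine_fun \<Rightarrow> real" where
  "aff_form f g = fst f \<bullet> fst g"

definition half_plane :: "affine_fun \<Rightarrow> (real ^ 2) set" where
  "half_plane f = {x. aff_eval f x < 0}"

definition zero_line :: "affine_fun \<Rightarrow> (real ^ 2) set" where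
  "zero_line f = {x. aff_eval f x = 0}"

definition affine_basis :: "(3 \<Rightarrow> affine_fun) \<Rightarrow> bool" where
  "affine_basis v \<longleftrightarrow> inj v \<and> independent (range v) \<and> span (range v) = UNIV"

text \<open>In \<open>3\<close> the numeral \<open>3\<close> equals \<open>0\<close>, so the order on the indices is \<open>3 < 1 < 2\<close>. It only
  serves to pick each unordered pair once, and \<^const>\<open>aff_form\<close> is symmetric.\<close>

definition geometric_realisation :: "(3 \<Rightarrow> affine_fun) \<Rightarrow> real ^ 3 ^ 3 \<Rightarrow> bool" where
  "geometric_realisation v B \<longleftrightarrow>
     affine_basis v \<and>
     (\<forall>i. aff_form (v i) (v i) = 2) \<and>
     (\<forall>i j. i \<noteq> j \<longrightarrow> \<bar>aff_form (v i) (v j)\<bar> = \<bar>B $ i $ j\<bar>) \<and>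
     ((\<forall>i j. i \<noteq> j \<longrightarrow> aff_form (v i) (v j) \<noteq> 0) \<longrightarrow>
        (even (card {(i, j). i < j \<and> aff_form (v i) (v j) > 0}) \<longleftrightarrow> acyclic_matrix B))"


section \<open>Seeds and their mutations\<close>

type_synonym labelled_seed = "(3 \<Rightarrow> affine_fun) \<times> (real ^ 3 ^ 3)"

definition is_seed :: "labelled_seed \<Rightarrow> bool" where
  "is_seed s \<longleftrightarrow> (case s of (v, B) \<Rightarrow> exchange_matrix B \<and> geometric_realisation v B)"

text \<open>A seed without labels is a class of labelled seeds under simultaneous permutation of
  the indices.\<close>

definition relabelling :: "(labelled_seed \<times> labelled_seed) set" where
  "relabelling = {((v, B), (v', B')). \<exists>\<sigma> :: 3 \<Rightarrow> 3. bij \<sigma> \<and>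
      v' = v \<circ> \<sigma> \<and> B' = (\<chi> i j. B $ \<sigma> i $ \<sigma> j)}"

type_synonym seed = "labelled_seed set"

definition seed_of :: "labelled_seed \<Rightarrow> seed" where
  "seed_of s = relabelling `` {s}"

definition reflect :: "affine_fun \<Rightarrow> affine_fun \<Rightarrow> affine_fun" where
  "reflect w f = f - aff_form f w *\<^sub>R w"

text \<open>The predicate \<open>pos\<close> is the notion of positive vectors; \<open>f\<close> is negative iff \<open>- f\<close> is
  positive. Mutation is a relation because it is undefined at a vector which is neither. When
  \<open>B $ i $ k = 0\<close>, the vectors \<open>v i\<close> and \<open>v k\<close> of a seed are orthogonal, so that \<open>v i\<close> equals
  its own reflection.\<close>

definition labelled_mutation ::
    "(affine_fun \<Rightarrow> bool) \<Rightarrow> 3 \<Rightarrow> labelled_seed \<Rightarrow> labelled_seed \<Rightarrow> bool" where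
  "labelled_mutation pos k s s' \<longleftrightarrow> (case (s, s') of ((v, B), (v', B')) \<Rightarrow>
     B' = matrix_mutation k B \<and> v' k = - v k \<and>
     (pos (v k) \<and>
        (\<forall>i. i \<noteq> k \<longrightarrow> v' i = (if B $ i $ k < 0 then reflect (v k) (v i) else v i)) \<or>
      pos (- v k) \<and>
        (\<forall>i. i \<noteq> k \<longrightarrow> v' i = (if B $ i $ k > 0 then reflect (v k) (v i) else v i))))"

definition seed_mutation :: "(affine_fun \<Rightarrow> bool) \<Rightarrow> (seed \<times> seed) set" where
  "seed_mutation pos =
     {(S, S'). \<exists>s s' k. S = seed_of s \<and> S' = seed_of s' \<and> labelled_mutation pos k s s'}"


section \<open>Exchange graphs and growth\<close>

definition exchange_vertices :: "(affine_fun \<Rightarrow> bool) \<Rightarrow> seed \<Rightarrow> seed set" where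
  "exchange_vertices pos x0 = (seed_mutation pos)\<^sup>* `` {x0}"

definition exchange_edges :: "(affine_fun \<Rightarrow> bool) \<Rightarrow> seed \<Rightarrow> (seed \<times> seed) set" where
  "exchange_edges pos x0 =
     (seed_mutation pos \<union> (seed_mutation pos)\<inverse>) \<inter>
     (exchange_vertices pos x0 \<times> exchange_vertices pos x0)"

text \<open>The distance is only meaningful for vertices in the same connected component.\<close>

definition graph_dist :: "('a \<times> 'a) set \<Rightarrow> 'a \<Rightarrow> 'a \<Rightarrow> nat" where
  "graph_dist E x y = (LEAST l. (x, y) \<in> E ^^ l)"

definition graph_growth :: "'a set \<Rightarrow> ('a \<times> 'a) set \<Rightarrow> 'a \<Rightarrow> nat \<Rightarrow> nat" where
  "graph_growth V E x0 m = card {x \<in> V. graph_dist E x0 x \<le> m}"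

definition exchange_growth :: "(affine_fun \<Rightarrow> bool) \<Rightarrow> labelled_seed \<Rightarrow> nat \<Rightarrow> nat" where
  "exchange_growth pos s =
     (let x0 = seed_of s
      in graph_growth (exchange_vertices pos x0) (exchange_edges pos x0) x0)"

definition polynomial_growth :: "(nat \<Rightarrow> nat) \<Rightarrow> bool" where
  "polynomial_growth gr \<longleftrightarrow> (\<exists>r::real. r \<ge> 0 \<and> (\<lambda>m. real (gr m)) \<in> O(\<lambda>m. real m powr r))"

definition polynomial_growth_rate :: "(nat \<Rightarrow> nat) \<Rightarrow> nat" where
  "polynomial_growth_rate gr = (LEAST r. (\<lambda>m. real (gr m)) \<in> O(\<lambda>m. real m ^ r))"


section \<open>The initial triangle, the belt line and the reference point\<close>

definition angle_at :: "real ^ 2 \<Rightarrow> real ^ 2 \<Rightarrow> real ^ 2 \<Rightarrow> real" where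
  "angle_at Q P R = arccos ((P - Q) \<bullet> (R - Q) / (norm (P - Q) * norm (R - Q)))"

definition initial_triangle :: "nat \<Rightarrow> real ^ 2 \<Rightarrow> real ^ 2 \<Rightarrow> real ^ 2 \<Rightarrow> bool" where
  "initial_triangle n X Y Z \<longleftrightarrow>
     (let \<alpha> = pi / real (2 * n + 1)
      in \<not> collinear {X, Y, Z} \<and> dist X Z = dist Y Z \<and>
         angle_at X Y Z = real n * \<alpha> \<and> angle_at Y X Z = real n * \<alpha> \<and> angle_at Z X Y = \<alpha>)"

text \<open>The indices 1, 2, 3 label the sides \<open>XY\<close>, \<open>XZ\<close>, \<open>YZ\<close>.\<close>

definition initial_seed ::
    "real ^ 2 \<Rightarrow> real ^ 2 \<Rightarrow> real ^ 2 \<Rightarrow> labelled_seed \<Rightarrow> bool" where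
  "initial_seed X Y Z s \<longleftrightarrow> is_seed s \<and>
     (case s of (v, B) \<Rightarrow>
        (\<Inter>i. half_plane (v i)) = interior (convex hull {X, Y, Z}) \<and>
        zero_line (v 1) = affine hull {X, Y} \<and>
        zero_line (v 2) = affine hull {X, Z} \<and>
        zero_line (v 3) = affine hull {Y, Z} \<and>
        B $ 1 $ 2 > 0 \<and> B $ 1 $ 3 > 0 \<and> B $ 2 $ 3 > 0)"

definition altitude_foot :: "real ^ 2 \<Rightarrow> real ^ 2 \<Rightarrow> real ^ 2 \<Rightarrow> real ^ 2 \<Rightarrow> bool" where
  "altitude_foot A P Q F \<longleftrightarrow> F \<in> affine hull {P, Q} \<and> (A - F) \<bullet> (Q - P) = 0"

text \<open>Positivity with respect to the point infinitely far away on the line through \<open>F\<close> and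
  \<open>G\<close>, in the direction from \<open>F\<close> to \<open>G\<close>.\<close>

definition positive_wrt :: "real ^ 2 \<Rightarrow> real ^ 2 \<Rightarrow> affine_fun \<Rightarrow> bool" where
  "positive_wrt F G f \<longleftrightarrow> (\<forall>\<^sub>F t in at_top. F + t *\<^sub>R (G - F) \<in> half_plane f)"

end

theory Submission
  imports Defs "HOL-Computational_Algebra.Polynomial"
begin

text \<open>
  Put \<open>q = 2 * n + 1\<close> and \<open>\<alpha> = pi / q\<close>, and use the belt line as the \<open>x\<close>-axis, directed towards
  the reference point. The initial triangle belongs to a family of seeds that depends on a sign
  \<open>\<sigma>\<close> (reflection in the belt line), two integers \<open>1 \<le> a \<le> n\<close> and \<open>0 \<le> c \<le> n\<close>, and a real number
  \<open>x\<close>. One side meets the belt line at the point \<open>x\<close> under the angle \<open>a * \<alpha>\<close>, another one has the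
  angle \<open>c * \<alpha>\<close> with it and the third one the angle \<open>(c - a) * \<alpha>\<close>; after a choice of the unit of
  length this fixes the whole seed, since up to sign the determinant of the three vectors is a
  mutation invariant. The family is closed under mutation (\<open>mutation_seed_cases\<close>): the mutation
  in the third side is a step of the subtractive Euclidean algorithm on \<open>(a, c)\<close>; if \<open>a + c > n\<close>,
  the quiver is acyclic, the triangle has the angles \<open>a * \<alpha>\<close>, \<open>c * \<alpha>\<close>, \<open>(q - a - c) * \<alpha>\<close>, and the
  two other mutations permute these cyclically while reflecting in the belt line; if \<open>a + c \<le> n\<close>,
  the two other mutations are inverse Euclidean steps. In each case \<open>x\<close> changes by \<open>0\<close> or by \<open>\<plusminus> 1
  \<plusminus> cot (i * \<alpha>) * cot (j * \<alpha>)\<close>. So there are finitely many shapes of seeds, and the growth is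
  that of the set of positions \<open>x\<close> which can be reached.

  Upper bound. After \<open>l\<close> mutations, \<open>q\<^sup>2 * x\<close> is the value at a primitive \<open>q\<close>-th root of unity of
  an integer polynomial whose values at all primitive \<open>q\<close>-th roots of unity are real and \<open>O(l)\<close>.
  These values come in \<open>\<phi>(q) / 2\<close> equal pairs. If two such polynomials have nearly the same
  values at all of these roots, then their difference \<open>D\<close> satisfies \<open>\<bar>trace (D\<^sup>2)\<bar> < 1\<close>; this
  trace is an integer and a sum of squares, so \<open>D\<close> vanishes. Counting cubes in dimension \<open>\<phi>(q) /
  2\<close> gives \<open>O(l ^ (\<phi>(q) / 2))\<close> positions (\<open>card_bounded_conjugates\<close>).

  Lower bound. At a seed of shape \<open>(a, 0)\<close> the Euclidean step degenerates: it keeps the shape and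
  translates by \<open>1 / (sin (a * \<alpha>))\<^sup>2\<close>. All shapes \<open>(a, 0)\<close> with \<open>a\<close> coprime to \<open>q\<close> can be reached
  (\<open>linked_origin\<close>), and translations along the belt line commute with mutations, so walks to
  these shapes, loops there and the walks back realise all sums of these \<open>\<phi>(q) / 2\<close> translations
  with natural coefficients. The sums are distinct (\<open>inverse_sin_squared_independent\<close>): an
  integer relation between the numbers \<open>1 / (sin (a * \<alpha>))\<^sup>2\<close> remains true when all \<open>a\<close> are
  multiplied by a unit modulo \<open>q\<close>, because primitive \<open>q\<close>-th roots of unity are conjugate
  (\<open>ev_conjugate_eq_0\<close>); and \<open>1 / (sin \<alpha>)\<^sup>2\<close> exceeds the sum of all the others, so that the
  coefficient of largest absolute value, moved to this position, must be zero.
\<close>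


section \<open>Mutation and relabelling\<close>

definition relabel :: "(3 \<Rightarrow> 3) \<Rightarrow> labelled_seed \<Rightarrow> labelled_seed" where
  "relabel \<sigma> s = (fst s \<circ> \<sigma>, \<chi> i j. snd s $ \<sigma> i $ \<sigma> j)"

lemma mem_seed_of: "t \<in> seed_of s \<longleftrightarrow> (\<exists>\<sigma>. bij \<sigma> \<and> t = relabel \<sigma> s)"
  by (cases s; cases t) (auto simp: seed_of_def relabelling_def relabel_def)

lemma relabel_id: "relabel id s = s"
  by (cases s) (simp add: relabel_def vec_eq_iff)

lemma relabel_relabel: "relabel \<sigma> (relabel \<tau> s) = relabel (\<tau> \<circ> \<sigma>) s"
  by (simp add: relabel_def vec_eq_iff fun_eq_iff)

lemma seed_of_relabel:
  assumes "bij \<sigma>"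
  shows "seed_of (relabel \<sigma> s) = seed_of s"
proof (intro set_eqI iffI)
  fix t assume "t \<in> seed_of (relabel \<sigma> s)"
  then show "t \<in> seed_of s"
    unfolding mem_seed_of using assms by (metis relabel_relabel bij_comp)
next
  fix t assume "t \<in> seed_of s"
  then obtain \<tau> where t: "bij \<tau>" "t = relabel \<tau> s"
    unfolding mem_seed_of by blast
  have "t = relabel (inv \<sigma> \<circ> \<tau>) (relabel \<sigma> s)"
    using assms by (simp add: t relabel_relabel o_assoc bij_is_surj surj_iff[THEN iffD1])
  then show "t \<in> seed_of (relabel \<sigma> s)"
    unfolding mem_seed_of using t assms by (metis bij_comp bij_imp_bij_inv)
qed

lemma seed_of_eqD:
  assumes "seed_of s = seed_of t"
  shows "\<exists>\<sigma>. bij \<sigma> \<and> s = relabel \<sigma> t"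
proof -
  have "s \<in> seed_of s"
    unfolding mem_seed_of by (metis relabel_id bij_id)
  then show ?thesis using assms mem_seed_of by blast
qed

lemma labelled_mutation_relabel:
  assumes "bij \<sigma>" and "labelled_mutation pos (\<sigma> k) s s'"
  shows "labelled_mutation pos k (relabel \<sigma> s) (relabel \<sigma> s')"
proof -
  have eq: "\<sigma> i = \<sigma> k \<longleftrightarrow> i = k" for i
    using assms(1) by (metis bij_pointE)
  show ?thesis
    using assms(2)
    by (cases s; cases s')
      (auto simp: labelled_mutation_def relabel_def matrix_mutation_def vec_eq_iff eq)
qed

lemma reflect_reflect:
  assumes "aff_form w w = 2"
  shows "reflect (- w) (reflect w f) = f"
proof -
  have "aff_form (reflect w f) (- w) = aff_form f w"
    using assms by (simp add: reflect_def aff_form_def inner_diff_left algebra_simps)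
  then show ?thesis
    by (simp add: reflect_def)
qed

text \<open>Mutation is an involution: after it, \<open>v k\<close> and column \<open>k\<close> of \<open>B\<close> have changed sign, so the
  other case of the mutation rule applies and reflects the same vectors in the same line again.\<close>

lemma labelled_mutation_sym:
  assumes "aff_form (fst s k) (fst s k) = 2" and "labelled_mutation pos k s s'"
  shows "labelled_mutation pos k s' s"
proof -
  obtain v B v' B' where [simp]: "s = (v, B)" "s' = (v', B')"
    by (metis surj_pair)
  have B': "B' = matrix_mutation k B" and vk: "v' k = - v k"
    using assms(2) by (auto simp: labelled_mutation_def)
  have Bk: "B' $ i $ k = - B $ i $ k" "B' $ k $ i = - B $ k $ i" for i
    by (auto simp: B' matrix_mutation_def)
  have BB: "B = matrix_mutation k B'"
  proof -
    have "B $ i $ j = matrix_mutation k B' $ i $ j" for i j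
    proof (cases "i = k \<or> j = k")
      case True
      then show ?thesis by (auto simp: matrix_mutation_def Bk)
    next
      case False
      then show ?thesis
        using Bk by (simp add: matrix_mutation_def[of k B'] Bk)
          (simp add: B' matrix_mutation_def field_simps)
    qed
    then show ?thesis by (simp add: vec_eq_iff)
  qed
  have rr: "reflect (- v k) (reflect (v k) f) = f" for f
    using assms(1) reflect_reflect by simp
  show ?thesis
    using assms(2) BB
    by (auto simp: labelled_mutation_def vk Bk rr)
qed

lemma labelled_mutation_unique:
  assumes "\<And>f. \<not> (pos f \<and> pos (- f))"
    and "labelled_mutation pos k s s'" and "labelled_mutation pos k s s''"
  shows "s'' = s'"
proof -
  obtain v B v' B' v'' B'' where [simp]: "s = (v, B)" "s' = (v', B')" "s'' = (v'', B'')"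
    by (metis surj_pair)
  have "pos (v k) \<Longrightarrow> \<not> pos (- v k)"
    using assms(1) by blast
  then have "v'' i = v' i" for i
    using assms(2,3) by (cases "i = k") (auto simp: labelled_mutation_def)
  then show ?thesis
    using assms(2,3) by (auto simp: labelled_mutation_def)
qed

text \<open>Since mutations commute with relabelling, the mutations of an unlabelled seed can be read
  off from any one of its labellings.\<close>

lemma seed_mutation_seed_of_iff:
  "(seed_of s, S') \<in> seed_mutation pos \<longleftrightarrow>
     (\<exists>k s'. labelled_mutation pos k s s' \<and> S' = seed_of s')"
proof
  assume "(seed_of s, S') \<in> seed_mutation pos"
  then obtain t t' k where t: "seed_of s = seed_of t" "S' = seed_of t'"
      "labelled_mutation pos k t t'"
    by (auto simp: seed_mutation_def)
  obtain \<sigma> where \<sigma>: "bij \<sigma>" "s = relabel \<sigma> t"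
    using seed_of_eqD[OF t(1)] by blast
  obtain k' where "k = \<sigma> k'"
    using \<sigma>(1) by (metis bij_pointE)
  then have "labelled_mutation pos k' s (relabel \<sigma> t')"
    using labelled_mutation_relabel[OF \<sigma>(1)] t(3) \<sigma>(2) by blast
  then show "\<exists>k s'. labelled_mutation pos k s s' \<and> S' = seed_of s'"
    using seed_of_relabel[OF \<sigma>(1)] t(2) by metis
next
  assume "\<exists>k s'. labelled_mutation pos k s s' \<and> S' = seed_of s'"
  then show "(seed_of s, S') \<in> seed_mutation pos"
    unfolding seed_mutation_def by blast
qed


definition triple ::
    "affine_fun \<Rightarrow> affine_fun \<Rightarrow> affine_fun \<Rightarrow> real \<Rightarrow> real \<Rightarrow> real \<Rightarrow> labelled_seed" where
  "triple v1 v2 v3 b12 b13 b23 =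
     ((\<lambda>i. if i = 1 then v1 else if i = 2 then v2 else v3),
      vector [vector [0, b12, b13], vector [- b12, 0, b23], vector [- b13, - b23, 0]])"

lemma neq_3 [simp]:
  "(1::3) \<noteq> 2" "(2::3) \<noteq> 1" "(1::3) \<noteq> 3" "(3::3) \<noteq> 1" "(2::3) \<noteq> 3" "(3::3) \<noteq> 2"
  by simp_all

lemma relabel_triple_23:
  "relabel (Transposition.transpose 2 3) (triple v1 v2 v3 b12 b13 b23)
     = triple v1 v3 v2 b13 b12 (- b23)"
  by (simp add: relabel_def triple_def fun_eq_iff vec_eq_iff forall_3 transpose_def)

lemma relabel_triple_12:
  "relabel (Transposition.transpose 1 2) (triple v1 v2 v3 b12 b13 b23)
     = triple v2 v1 v3 (- b12) b23 b13"
  by (simp add: relabel_def triple_def fun_eq_iff vec_eq_iff forall_3 transpose_def)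

lemma relabel_triple_rotate:
  "relabel (Transposition.transpose 2 3 \<circ> Transposition.transpose 1 2) (triple v1 v2 v3 b12 b13 b23)
     = triple v3 v1 v2 (- b13) (- b23) b12"
  by (simp add: relabel_def triple_def fun_eq_iff vec_eq_iff forall_3 transpose_def)

lemma mutation_triple_2_pos:
  assumes "pos v2" "b12 > 0" "b23 > 0"
  shows "labelled_mutation pos 2 (triple v1 v2 v3 b12 b13 b23)
           (triple v1 (- v2) (reflect v2 v3) (- b12) (b13 + b12 * b23) (- b23))"
  using assms
  by (simp add: labelled_mutation_def triple_def forall_3 vec_eq_iff matrix_mutation_def)

lemma mutation_triple_2_neg:
  assumes "pos (- v2)" "b12 > 0" "b23 > 0"
  shows "labelled_mutation pos 2 (triple v1 v2 v3 b12 b13 b23)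
           (triple (reflect v2 v1) (- v2) v3 (- b12) (b13 + b12 * b23) (- b23))"
  using assms
  by (simp add: labelled_mutation_def triple_def forall_3 vec_eq_iff matrix_mutation_def)

lemma mutation_triple_1_pos:
  assumes "pos v1" "b12 > 0" "b13 > 0"
  shows "labelled_mutation pos 1 (triple v1 v2 v3 b12 b13 b23)
           (triple (- v1) (reflect v1 v2) (reflect v1 v3) (- b12) (- b13) b23)"
  using assms
  by (simp add: labelled_mutation_def triple_def forall_3 vec_eq_iff matrix_mutation_def)

text \<open>Half of the mutations of the seeds along a belt line are only computed in one direction;
  the opposite direction follows from this.\<close>

lemma labelled_mutation_reverse:
  assumes "bij \<tau>" "aff_form (fst s k) (fst s k) = 2"
    and "labelled_mutation pos k s (relabel \<tau> t)"
  shows "labelled_mutation pos (\<tau> k) t (relabel (inv \<tau>) s)"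
proof -
  have "labelled_mutation pos (inv \<tau> (\<tau> k)) (relabel \<tau> t) s"
    using labelled_mutation_sym[OF assms(2,3)] assms(1) by (simp add: bij_is_inj)
  then have "labelled_mutation pos (\<tau> k) (relabel (inv \<tau>) (relabel \<tau> t)) (relabel (inv \<tau>) s)"
    using labelled_mutation_relabel[of "inv \<tau>"] assms(1) bij_imp_bij_inv by blast
  then show ?thesis
    using assms(1) by (simp add: relabel_relabel bij_is_surj surj_iff[THEN iffD1] relabel_id)
qed


section \<open>Seeds along a belt line\<close>

text \<open>The belt line runs through \<open>F\<close> in the direction of the unit vector \<open>e\<close>, and \<open>d\<close> is a unit
  normal of it. The unit of length along the line is \<open>\<kappa>\<close>. The number \<open>h\<close> only describes the
  second point \<open>F + h *\<^sub>R e\<close> by which the reference point is given.\<close>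

locale belt =
  fixes F e d :: "real ^ 2" and \<kappa> h :: real
  assumes ee: "e \<bullet> e = 1" and dd: "d \<bullet> d = 1" and ed: "e \<bullet> d = 0"
    and \<kappa>: "\<kappa> > 0" and h: "h > 0"
begin

definition unit_normal :: "real \<Rightarrow> real \<Rightarrow> real ^ 2" where
  "unit_normal \<sigma> \<theta> = sin \<theta> *\<^sub>R e - (\<sigma> * cos \<theta>) *\<^sub>R d"

text \<open>In the coordinates \<open>(p, r)\<close> of the point \<open>F + p *\<^sub>R e + r *\<^sub>R d\<close>, this is the function
  \<open>sqrt 2 * (sin \<theta> * p - \<sigma> * cos \<theta> * r - \<kappa> * w)\<close>. The offset \<open>w\<close> is used instead of the
  intersection with the belt line because lines parallel to the belt line do occur. The sign \<open>\<sigma>\<close>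
  implements the reflection in the belt line.\<close>

definition side :: "real \<Rightarrow> real \<Rightarrow> real \<Rightarrow> affine_fun" where
  "side \<sigma> \<theta> w = sqrt 2 *\<^sub>R (unit_normal \<sigma> \<theta>, - (\<kappa> * w) - unit_normal \<sigma> \<theta> \<bullet> F)"

abbreviation "pos \<equiv> positive_wrt F (F + h *\<^sub>R e)"

lemma side_cong:
  assumes "sin \<theta> = sin \<theta>'" "\<sigma> * cos \<theta> = \<sigma>' * cos \<theta>'" "w = w'"
  shows "side \<sigma> \<theta> w = side \<sigma>' \<theta>' w'"
  by (simp add: side_def unit_normal_def assms)

lemma inner_unit_normal:
  assumes "\<sigma> * \<sigma> = 1"
  shows "unit_normal \<sigma> \<theta> \<bullet> unit_normal \<sigma> \<phi> = cos (\<theta> - \<phi>)"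
proof -
  have "unit_normal \<sigma> \<theta> \<bullet> unit_normal \<sigma> \<phi> = sin \<theta> * sin \<phi> + (\<sigma> * \<sigma>) * (cos \<theta> * cos \<phi>)"
    by (simp add: unit_normal_def inner_diff_left inner_diff_right ee dd ed inner_commute[of d e])
  then show ?thesis by (simp add: assms cos_diff)
qed

lemma aff_form_side:
  assumes "\<sigma> * \<sigma> = 1"
  shows "aff_form (side \<sigma> \<theta> w) (side \<sigma> \<phi> u) = 2 * cos (\<theta> - \<phi>)"
  by (simp add: aff_form_def side_def inner_unit_normal[OF assms])

lemma uminus_side: "- side \<sigma> \<theta> w = side \<sigma> (\<theta> + pi) (- w)"
  by (simp add: side_def unit_normal_def algebra_simps inner_diff_left)

text \<open>A reflection maps a direction \<open>\<theta>\<close> to \<open>2 * \<psi> - \<theta>\<close>, where \<open>\<psi>\<close> is the direction of the mirror.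
  Here the mirror is orthogonal to the normal with angle \<open>\<phi>\<close>, whence the summand \<open>pi\<close>.\<close>

lemma reflect_side:
  assumes "\<sigma> * \<sigma> = 1"
  shows "reflect (side \<sigma> \<phi> u) (side \<sigma> \<theta> w)
           = side \<sigma> (2 * \<phi> - \<theta> + pi) (w - 2 * cos (\<theta> - \<phi>) * u)"
proof -
  define \<delta> where "\<delta> = \<theta> - \<phi>"
  have \<theta>: "\<theta> = \<phi> + \<delta>" and \<phi>: "2 * \<phi> - \<theta> = \<phi> - \<delta>"
    by (simp_all add: \<delta>_def)
  have s: "sin (2 * \<phi> - \<theta> + pi) = sin \<theta> - 2 * cos (\<theta> - \<phi>) * sin \<phi>"
    unfolding \<phi> unfolding \<theta> by (simp add: sin_add sin_diff)
  have c: "cos (2 * \<phi> - \<theta> + pi) = cos \<theta> - 2 * cos (\<theta> - \<phi>) * cos \<phi>"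
    unfolding \<phi> unfolding \<theta> by (simp add: cos_add cos_diff)
  have n: "unit_normal \<sigma> (2 * \<phi> - \<theta> + pi)
      = unit_normal \<sigma> \<theta> - (2 * cos (\<theta> - \<phi>)) *\<^sub>R unit_normal \<sigma> \<phi>"
    unfolding unit_normal_def s c by (simp add: algebra_simps)
  show ?thesis
    unfolding reflect_def aff_form_side[OF assms]
    unfolding side_def n by (simp add: algebra_simps inner_diff_left)
qed

lemma pos_side:
  assumes "sin \<theta> < 0 \<or> sin \<theta> = 0 \<and> w > 0"
  shows "pos (side \<sigma> \<theta> w)"
proof -
  have eval: "aff_eval (side \<sigma> \<theta> w) (F + (t * h) *\<^sub>R e) = sqrt 2 * (h * sin \<theta> * t - \<kappa> * w)"
    for t
  proof -
    have "unit_normal \<sigma> \<theta> \<bullet> e = sin \<theta>"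
      by (simp add: unit_normal_def inner_diff_left ee ed inner_commute[of d e])
    then show ?thesis
      by (simp add: aff_eval_def side_def inner_add_right algebra_simps)
  qed
  have "\<forall>\<^sub>F t in at_top. h * sin \<theta> * t - \<kappa> * w < 0"
  proof (cases "sin \<theta> = 0")
    case True
    then show ?thesis using assms \<kappa> by simp
  next
    case False
    then have s: "h * sin \<theta> < 0" using assms h by (simp add: mult_pos_neg)
    have "\<forall>\<^sub>F t in at_top. t > \<kappa> * w / (h * sin \<theta>)"
      by (rule eventually_gt_at_top)
    then show ?thesis
      by eventually_elim (use s in \<open>simp add: neg_divide_less_eq mult.commute\<close>)
  qed
  then show ?thesis
    unfolding positive_wrt_def half_plane_def mem_Collect_eq
    by (simp add: eval mult_less_0_iff)
qed

lemma not_pos_both: "\<not> (pos f \<and> pos (- f))"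
proof
  assume "pos f \<and> pos (- f)"
  then have "\<forall>\<^sub>F t in at_top. (F + t *\<^sub>R (F + h *\<^sub>R e - F)) \<in> half_plane f
      \<and> (F + t *\<^sub>R (F + h *\<^sub>R e - F)) \<in> half_plane (- f)"
    unfolding positive_wrt_def by (simp add: eventually_conj_iff)
  then have "\<forall>\<^sub>F t :: real in at_top. False"
    by eventually_elim (auto simp: half_plane_def aff_eval_def)
  then show False by simp
qed

text \<open>For acute angles \<open>A\<close> and \<open>C\<close> with \<open>A + C > pi / 2\<close> this is the acute triangle with angle
  \<open>A\<close> opposite to the source (label 1), angle \<open>C\<close> opposite to the sink (label 3) and orthic
  triangle of perimeter \<open>2 * \<kappa>\<close>, placed so that the feet of the altitudes on source and sink lie
  on the belt line and the first foot is the point \<open>F + (\<kappa> * x) *\<^sub>R e\<close>. The feet determine the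
  offsets: for any two sides \<open>i\<close> and \<open>j\<close> that are not parallel to the belt line, their
  intersections with it differ by \<open>\<kappa> * (1 + cot \<theta>\<^sub>i * cot \<theta>\<^sub>j)\<close>, up to sign. The same formulas
  with \<open>A + C < pi / 2\<close> describe the seeds with cyclic quiver.\<close>

definition belt_seed :: "real \<Rightarrow> real \<Rightarrow> real \<Rightarrow> real \<Rightarrow> labelled_seed" where
  "belt_seed \<sigma> A C x =
     triple (side \<sigma> (A + pi) (- (x * sin A)))
       (side \<sigma> (A - C) (x * sin (A - C) + cos C / sin A))
       (side \<sigma> (pi - C) (x * sin C - cos (A + C) / sin A))
       (2 * cos C) (- 2 * cos (A + C)) (2 * cos A)"

text \<open>The vector of label 2 is positive here, so the sink is reflected in it. The source does not
  move, hence neither \<open>A\<close> nor \<open>x\<close> changes, while the old middle line becomes the new sink.\<close>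

lemma mutate_middle_le:
  assumes \<sigma>: "\<sigma> * \<sigma> = 1" and A: "0 < A" "A \<le> C" "C < pi / 2"
  shows "labelled_mutation pos 2 (belt_seed \<sigma> A C x)
           (relabel (Transposition.transpose 2 3) (belt_seed \<sigma> A (C - A) x))"
proof -
  have sA: "sin A > 0" using A by (intro sin_gt_zero) auto
  have cC: "cos C > 0" using A by (intro cos_gt_zero_pi) auto
  have cA: "cos A > 0" using A by (intro cos_gt_zero_pi) auto
  have p: "pos (side \<sigma> (A - C) (x * sin (A - C) + cos C / sin A))"
  proof (rule pos_side)
    show "sin (A - C) < 0 \<or> sin (A - C) = 0 \<and> x * sin (A - C) + cos C / sin A > 0"
    proof (cases "A = C")
      case True
      then show ?thesis using sA cC by simp
    next
      case False
      then have "sin (C - A) > 0" using A by (intro sin_gt_zero) auto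
      then show ?thesis using sin_minus[of "C - A"] by simp
    qed
  qed
  define D where "D = A - C"
  have C: "C = A - D" by (simp add: D_def)
  have 1: "cos (pi - C - (A - C)) = - cos A" by simp
  have 2: "sin (A - (C - A)) = sin C + 2 * cos A * sin (A - C)"
    unfolding C by (simp add: sin_add sin_diff algebra_simps)
  have 3: "cos (C - A) = 2 * cos A * cos C - cos (A + C)"
    by (simp add: cos_add cos_diff)
  have vs: "side \<sigma> (A - C + pi) (- (x * sin (A - C) + cos C / sin A))
     = side \<sigma> (pi - (C - A)) (x * sin (C - A) - cos (A + (C - A)) / sin A)"
    using sin_minus[of "C - A"] by (intro side_cong) (simp_all add: algebra_simps)
  have vt: "side \<sigma> (2 * (A - C) - (pi - C) + pi)
      (x * sin C - cos (A + C) / sin A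
        - 2 * cos (pi - C - (A - C)) * (x * sin (A - C) + cos C / sin A))
    = side \<sigma> (A - (C - A)) (x * sin (A - (C - A)) + cos (C - A) / sin A)"
    unfolding 1 2 3
    by (intro side_cong) (use sA in \<open>simp_all add: field_simps\<close>)
  show ?thesis
    using mutation_triple_2_pos[of pos, OF p, of "2 * cos C" "2 * cos A"
        "side \<sigma> (A + pi) (- (x * sin A))" "side \<sigma> (pi - C) (x * sin C - cos (A + C) / sin A)"
        "- 2 * cos (A + C)"] cC cA
    unfolding belt_seed_def relabel_triple_23 reflect_side[OF \<sigma>] uminus_side vs vt
    by (simp add: 3 algebra_simps)
qed

text \<open>The vector of label 2 is negative here, so the source is reflected in it and the sink does
  not move. The middle line becomes the new source, and the position changes by the distance
  between the points where these two lines meet the belt line.\<close>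

lemma mutate_middle_gt:
  assumes \<sigma>: "\<sigma> * \<sigma> = 1" and A: "0 \<le> C" "C < A" "A < pi / 2"
  shows "labelled_mutation pos 2 (belt_seed \<sigma> A C x)
           (relabel (Transposition.transpose 1 2)
              (belt_seed \<sigma> (A - C) C (x + cos C / (sin A * sin (A - C)))))"
proof -
  have sA: "sin A > 0" using A by (intro sin_gt_zero) auto
  have sAC: "sin (A - C) > 0" using A by (intro sin_gt_zero) auto
  have cC: "cos C > 0" using A by (intro cos_gt_zero_pi) auto
  have cA: "cos A > 0" using A by (intro cos_gt_zero_pi) auto
  define x' where "x' = x + cos C / (sin A * sin (A - C))"
  define w where "w = x * sin (A - C) + cos C / sin A"
  have p: "pos (- side \<sigma> (A - C) w)"
    unfolding uminus_side by (rule pos_side) (use sAC in simp)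
  define D where "D = A - C"
  have AC: "A = D + C" by (simp add: D_def)
  have 1: "cos (A + pi - (A - C)) = - cos C" by (simp add: add.commute)
  have 2: "sin (A - C - C) = 2 * cos C * sin (A - C) - sin A"
    unfolding AC by (simp add: sin_add sin_diff algebra_simps)
  have 3: "cos (A - C) = 2 * cos A * cos C - cos (A + C)"
    by (simp add: cos_add cos_diff)
  have 4: "cos C * sin C - cos A * sin A = - (cos (A + C) * sin (A - C))"
  proof -
    show ?thesis
      using sin_cos_squared_add3[of A] sin_cos_squared_add3[of C]
      unfolding cos_add sin_diff by algebra
  qed
  have vs: "side \<sigma> (A - C + pi) (- w) = side \<sigma> (A - C + pi) (- (x' * sin (A - C)))"
    using sA sAC by (intro side_cong) (simp_all add: x'_def w_def field_simps)
  have vm: "side \<sigma> (2 * (A - C) - (A + pi) + pi)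
      (- (x * sin A) - 2 * cos (A + pi - (A - C)) * w)
    = side \<sigma> (A - C - C) (x' * sin (A - C - C) + cos C / sin (A - C))"
    unfolding 1 2
    by (intro side_cong) (use sA sAC in \<open>simp_all add: x'_def w_def field_simps\<close>)
  have "x * sin C - cos (A + C) / sin A = x' * sin C - cos (A - C + C) / sin (A - C)"
  proof -
    have "x' * sin C - cos (A - C + C) / sin (A - C)
        = x * sin C + (cos C * sin C - cos A * sin A) / (sin A * sin (A - C))"
      using sA sAC by (simp add: x'_def field_simps)
    then show ?thesis
      unfolding 4 using sA sAC by (simp add: field_simps)
  qed
  then have vt: "side \<sigma> (pi - C) (x * sin C - cos (A + C) / sin A)
     = side \<sigma> (pi - C) (x' * sin C - cos (A - C + C) / sin (A - C))"
    by simp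
  show ?thesis
    using mutation_triple_2_neg[of pos, OF p, of "2 * cos C" "2 * cos A"
        "side \<sigma> (A + pi) (- (x * sin A))" 
        "side \<sigma> (pi - C) (x * sin C - cos (A + C) / sin A)" "- 2 * cos (A + C)"] cC cA
    unfolding belt_seed_def relabel_triple_12 reflect_side[OF \<sigma>] uminus_side
      w_def[symmetric] x'_def[symmetric] vs vm
    unfolding vt
    by (simp add: 3 algebra_simps)
qed

text \<open>All three vectors change: the triangle is reflected in its source side, which becomes the
  sink. The image has the same belt line, because the two sides of the orthic triangle at the
  foot on the source make equal angles with this side. The roles of the sides, and with them the
  angles, are permuted cyclically, and \<open>\<sigma>\<close> changes because the orientation is reversed.\<close>

lemma mutate_source_acyclic:
  assumes \<sigma>: "\<sigma> * \<sigma> = 1" and A: "A < pi / 2" "C < pi / 2" "A + C > pi / 2"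
  shows "labelled_mutation pos 1 (belt_seed \<sigma> A C x)
           (relabel (Transposition.transpose 2 3 \<circ> Transposition.transpose 1 2)
              (belt_seed (- \<sigma>) (pi - A - C) A (x - 1 + cot A * cot (pi - A - C))))"
proof -
  define B where "B = pi - A - C"
  define x' where "x' = x - 1 + cot A * cot B"
  have C: "C = pi - (A + B)" by (simp add: B_def)
  have sA: "sin A > 0" using A by (intro sin_gt_zero) auto
  have sB: "sin B > 0" using A by (intro sin_gt_zero) (auto simp: B_def)
  have cB: "cos B > 0" using A by (intro cos_gt_zero_pi) (auto simp: B_def)
  have cC: "cos C > 0" using A by (intro cos_gt_zero_pi) auto
  have cAC: "cos (A + C) = - cos B" by (simp add: C)
  have p: "pos (side \<sigma> (A + pi) (- (x * sin A)))"
    by (rule pos_side) (use sA in simp)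
  have 1: "- 1 + cot A * cot B = cos (A + B) / (sin A * sin B)"
    using sA sB by (simp add: cot_def cos_add field_simps)
  have x': "x' = x + cos (A + B) / (sin A * sin B)"
    using 1 by (simp add: x'_def)
  have 4: "cos (A + B) * sin (B - A) + cos A * sin A = cos B * sin B"
  proof -
    show ?thesis
      using sin_cos_squared_add3[of A] sin_cos_squared_add3[of B]
      unfolding cos_add sin_diff by algebra
  qed
  have vt: "side \<sigma> (A + pi + pi) (- (- (x * sin A)))
    = side (- \<sigma>) (pi - A) (x' * sin A - cos (B + A) / sin B)"
  proof (rule side_cong)
    have a: "A + pi + pi = A + 2 * pi" by simp
    show "sin (A + pi + pi) = sin (pi - A)"
      unfolding a by (simp only: sin_periodic sin_pi_minus)
    show "\<sigma> * cos (A + pi + pi) = (- \<sigma>) * cos (pi - A)"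
      unfolding a by (simp only: cos_periodic cos_pi_minus minus_mult_minus)
    show "- (- (x * sin A)) = x' * sin A - cos (B + A) / sin B"
      using sA sB by (simp add: x' field_simps)
  qed
  have ws: "x * sin (A - C) + cos C / sin A - 2 * cos (A - C - (A + pi)) * - (x * sin A)
     = - (x' * sin B)"
  proof -
    have a: "sin (A - C) = 2 * cos C * sin A - sin B"
      using sin_diff[of A C] sin_add[of A C] sin_pi_minus[of "A + C"]
      by (simp add: B_def diff_diff_eq)
    have b: "cos (A - C - (A + pi)) = - cos C"
      using cos_minus[of "C + pi"] by simp
    have c: "cos C = - cos (A + B)" by (simp add: C)
    show ?thesis
      unfolding b a c x' using sA sB by (simp add: field_simps)
  qed
  have vs: "side \<sigma> (2 * (A + pi) - (A - C) + pi)
      (x * sin (A - C) + cos C / sin A - 2 * cos (A - C - (A + pi)) * - (x * sin A))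
     = side (- \<sigma>) (B + pi) (- (x' * sin B))"
    unfolding ws
  proof (rule side_cong)
    have a: "2 * (A + pi) - (A - C) + pi = A + C + pi + 2 * pi" by simp
    have b: "B + pi = 2 * pi - (A + C)" by (simp add: B_def)
    show "sin (2 * (A + pi) - (A - C) + pi) = sin (B + pi)"
      unfolding a b sin_periodic sin_periodic_pi sin_2pi_minus by simp
    show "\<sigma> * cos (2 * (A + pi) - (A - C) + pi) = (- \<sigma>) * cos (B + pi)"
      unfolding a b cos_periodic cos_periodic_pi cos_2pi_minus by simp
  qed simp
  have wm: "x * sin C - cos (A + C) / sin A - 2 * cos (pi - C - (A + pi)) * - (x * sin A)
     = x' * sin (B - A) + cos A / sin B"
  proof -
    have "cos (pi - C - (A + pi)) = - cos B"
    proof -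
      have "pi - C - (A + pi) = - (A + C)" by simp
      then show ?thesis by (simp only: cos_minus cAC)
    qed
    moreover have "sin C = sin (B - A) + 2 * cos B * sin A"
      by (simp add: C sin_add sin_diff)
    moreover have "x' * sin (B - A) + cos A / sin B
      = x * sin (B - A) + (cos (A + B) * sin (B - A) + cos A * sin A) / (sin A * sin B)"
      using sA sB by (simp add: x' field_simps)
    ultimately show ?thesis
      unfolding 4 cAC using sA sB by (simp add: field_simps)
  qed
  have vm: "side \<sigma> (2 * (A + pi) - (pi - C) + pi)
      (x * sin C - cos (A + C) / sin A - 2 * cos (pi - C - (A + pi)) * - (x * sin A))
     = side (- \<sigma>) (B - A) (x' * sin (B - A) + cos A / sin B)"
    unfolding wm
  proof (rule side_cong)
    have a: "2 * (A + pi) - (pi - C) + pi = (2 * A + C) + 2 * pi" by simp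
    have b: "B - A = pi - (2 * A + C)" by (simp add: B_def)
    show "sin (2 * (A + pi) - (pi - C) + pi) = sin (B - A)"
      unfolding a b by (simp only: sin_periodic sin_pi_minus)
    show "\<sigma> * cos (2 * (A + pi) - (pi - C) + pi) = (- \<sigma>) * cos (B - A)"
      unfolding a b by (simp only: cos_periodic cos_pi_minus minus_mult_minus)
  qed simp
  show ?thesis
    using mutation_triple_1_pos[of pos, OF p, of "2 * cos C" "- 2 * cos (A + C)"
        "side \<sigma> (A - C) (x * sin (A - C) + cos C / sin A)"
        "side \<sigma> (pi - C) (x * sin C - cos (A + C) / sin A)" "2 * cos A"] cC cB
    unfolding belt_seed_def relabel_triple_rotate reflect_side[OF \<sigma>] uminus_side
      B_def[symmetric] x'_def[symmetric] vs vm vt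
    by (simp add: cAC C algebra_simps)
qed

lemma aff_form_belt_seed:
  assumes "\<sigma> * \<sigma> = 1"
  shows "aff_form (fst (belt_seed \<sigma> A C x) k) (fst (belt_seed \<sigma> A C x) k) = 2"
  by (simp add: belt_seed_def triple_def aff_form_side[OF assms])

text \<open>The mutations in source and sink of a cyclic seed and the one in the sink of an acyclic
  seed are inverses of the three mutations computed before.\<close>

lemma mutation_seed_cases:
  assumes \<sigma>: "\<sigma> * \<sigma> = 1" and A: "0 < A" "A < pi / 2" "0 \<le> C" "C < pi / 2" "A + C \<noteq> pi / 2"
    and "(seed_of (belt_seed \<sigma> A C x), S') \<in> seed_mutation pos"
  obtains (middle_le) "A \<le> C" "S' = seed_of (belt_seed \<sigma> A (C - A) x)"
  | (middle_gt) "C < A"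
      "S' = seed_of (belt_seed \<sigma> (A - C) C (x + (1 + cot A * cot (A - C))))"
  | (source_acyclic) "A + C > pi / 2"
      "S' = seed_of (belt_seed (- \<sigma>) (pi - A - C) A (x + (- 1 + cot A * cot (pi - A - C))))"
  | (sink_acyclic) "A + C > pi / 2"
      "S' = seed_of (belt_seed (- \<sigma>) C (pi - A - C) (x - (- 1 + cot C * cot A)))"
  | (source_cyclic) "A + C < pi / 2"
      "S' = seed_of (belt_seed \<sigma> (A + C) C (x - (1 + cot (A + C) * cot A)))"
  | (sink_cyclic) "A + C < pi / 2" "S' = seed_of (belt_seed \<sigma> A (A + C) x)"
proof -
  let ?s = "belt_seed \<sigma> A C x"
  obtain k s' where k: "labelled_mutation pos k ?s s'" and S': "S' = seed_of s'"
    using assms(7) by (auto simp: seed_mutation_seed_of_iff)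
  have eq: "seed_of t = S'" if "labelled_mutation pos k ?s t" for t
    using labelled_mutation_unique[of pos, OF not_pos_both k that] S' by simp
  have gt: "cos C / (sin A * sin (A - C)) = 1 + cot A * cot (A - C)"
    if "0 \<le> C" "C < A" "A < pi / 2" for A C
  proof -
    have "sin A > 0" "sin (A - C) > 0" using that by (auto intro!: sin_gt_zero)
    moreover have "cos C = cos (A - (A - C))" by simp
    ultimately show ?thesis
      by (simp only: cos_diff[of A "A - C"]) (simp add: cot_def field_simps)
  qed
  let ?r = "Transposition.transpose 2 3 \<circ> Transposition.transpose 1 2 :: 3 \<Rightarrow> 3"
  have r: "bij ?r" by (simp add: bij_comp)
  note form = aff_form_belt_seed[OF \<sigma>]
  have \<sigma>': "(- \<sigma>) * (- \<sigma>) = 1" using \<sigma> by simp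
  consider "k = 1" | "k = 2" | "k = 3" using exhaust_3 by blast
  then show thesis
  proof cases
    case 1
    show thesis
    proof (cases "A + C < pi / 2")
      case True
      let ?u = "belt_seed \<sigma> (A + C) C (x - (1 + cot (A + C) * cot A))"
      have "labelled_mutation pos 2 ?u (relabel (Transposition.transpose 1 2) ?s)"
        using mutate_middle_gt[OF \<sigma>, of C "A + C" "x - (1 + cot (A + C) * cot A)"]
          gt[of C "A + C"] A True by simp
      from labelled_mutation_reverse[OF _ form this]
      have "seed_of (relabel (inv (Transposition.transpose 1 2)) ?u) = S'"
        by (intro eq) (simp add: 1)
      then show thesis
        using source_cyclic True seed_of_relabel[of "inv (Transposition.transpose 1 2 :: 3 \<Rightarrow> 3)"]
        by simp
    next
      case False
      then have "A + C > pi / 2" using A by simp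
      then show thesis
        using eq[unfolded 1, OF mutate_source_acyclic[OF \<sigma>]] A source_acyclic seed_of_relabel[OF r]
        by (simp add: algebra_simps)
    qed
  next
    case 2
    show thesis
    proof (cases "A \<le> C")
      case True
      then show thesis
        using eq[unfolded 2, OF mutate_middle_le[OF \<sigma>]] A middle_le
          seed_of_relabel[of "Transposition.transpose 2 3 :: 3 \<Rightarrow> 3"] by simp
    next
      case False
      then show thesis
        using eq[unfolded 2, OF mutate_middle_gt[OF \<sigma>]] A middle_gt gt
          seed_of_relabel[of "Transposition.transpose 1 2 :: 3 \<Rightarrow> 3"] by simp
    qed
  next
    case 3
    show thesis
    proof (cases "A + C < pi / 2")
      case True
      let ?u = "belt_seed \<sigma> A (A + C) x"
      have "labelled_mutation pos 2 ?u (relabel (Transposition.transpose 2 3) ?s)"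
        using mutate_middle_le[OF \<sigma>, of A "A + C" x] A True by simp
      from labelled_mutation_reverse[OF _ form this]
      have "seed_of (relabel (inv (Transposition.transpose 2 3)) ?u) = S'"
        by (intro eq) (simp add: 3)
      then show thesis
        using sink_cyclic True seed_of_relabel[of "inv (Transposition.transpose 2 3 :: 3 \<Rightarrow> 3)"]
        by simp
    next
      case False
      then have AC: "A + C > pi / 2" using A by simp
      let ?u = "belt_seed (- \<sigma>) C (pi - A - C) (x - (- 1 + cot C * cot A))"
      have "labelled_mutation pos 1 ?u (relabel ?r ?s)"
        using mutate_source_acyclic[OF \<sigma>', of C "pi - A - C" "x - (- 1 + cot C * cot A)"] A AC
        by simp
      from labelled_mutation_reverse[OF r aff_form_belt_seed[OF \<sigma>'] this]
      have "seed_of (relabel (inv ?r) ?u) = S'"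
        by (intro eq) (simp add: 3)
      then show thesis
        using sink_acyclic AC seed_of_relabel[OF bij_imp_bij_inv[OF r]] by simp
    qed
  qed
qed

text \<open>The vectors of one labelling must occur in the other one. The first vector of the first
  seed cannot be the second or third vector of the other seed, because their angles differ, and
  its own position determines \<open>x\<close>.\<close>

lemma belt_seed_inj:
  assumes \<sigma>: "\<sigma> * \<sigma> = 1" and A: "0 < A" "A < pi / 2" "0 \<le> C" "C < pi / 2"
    and eq: "seed_of (belt_seed \<sigma> A C x) = seed_of (belt_seed \<sigma> A C y)"
  shows "x = y"
proof -
  obtain \<tau> where \<tau>: "belt_seed \<sigma> A C x = relabel \<tau> (belt_seed \<sigma> A C y)"
    using seed_of_eqD[OF eq] by blast
  define s where "s = side \<sigma> (A + pi) (- (x * sin A))"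
  have "s = fst (belt_seed \<sigma> A C y) (\<tau> 1)"
    using fun_cong[OF arg_cong[OF \<tau>, of fst], of 1]
    by (simp add: relabel_def belt_seed_def triple_def s_def)
  then consider "s = side \<sigma> (A + pi) (- (y * sin A))"
    | "s = side \<sigma> (A - C) (y * sin (A - C) + cos C / sin A)"
    | "s = side \<sigma> (pi - C) (y * sin C - cos (A + C) / sin A)"
    by (auto simp: belt_seed_def triple_def split: if_splits)
  then show ?thesis
  proof cases
    case 1
    have "sin A > 0" using A by (intro sin_gt_zero) auto
    then show ?thesis using 1 \<kappa> by (auto simp: s_def side_def)
  next
    case 2
    have "aff_form s s = 2 * cos (A + pi - (A - C))"
      by (subst 2, subst s_def) (rule aff_form_side[OF \<sigma>])
    moreover have "aff_form s s = 2" by (simp add: s_def aff_form_side[OF \<sigma>])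
    moreover have "cos C > 0" using A by (intro cos_gt_zero_pi) auto
    ultimately show ?thesis by (simp add: add.commute)
  next
    case 3
    have "aff_form s s = 2 * cos (A + pi - (pi - C))"
      by (subst 3, subst s_def) (rule aff_form_side[OF \<sigma>])
    moreover have "aff_form s s = 2" by (simp add: s_def aff_form_side[OF \<sigma>])
    moreover have "cos (A + C) < 1" using cos_monotone_0_pi[of 0 "A + C"] A by simp
    ultimately show ?thesis by simp
  qed
qed

end


section \<open>The initial triangle\<close>

text \<open>In the plane two vectors orthogonal to the same \<open>w\<close> are parallel, so they agree up to sign
  when they have the same length.\<close>

lemma unit_normal_unique:
  fixes a b w :: "real ^ 2"
  assumes "a \<bullet> w = 0" "b \<bullet> w = 0" "w \<noteq> 0" "a \<bullet> a = 2" "b \<bullet> b = 2"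
  shows "a = b \<or> a = - b"
proof -
  have c: "a $ 1 * w $ 1 + a $ 2 * w $ 2 = 0" "b $ 1 * w $ 1 + b $ 2 * w $ 2 = 0"
    "a $ 1 * a $ 1 + a $ 2 * a $ 2 = 2" "b $ 1 * b $ 1 + b $ 2 * b $ 2 = 2"
    using assms by (simp_all add: inner_vec_def sum_2)
  have "(a $ 1 * b $ 2 - a $ 2 * b $ 1) * w $ 1 = 0" "(a $ 1 * b $ 2 - a $ 2 * b $ 1) * w $ 2 = 0"
    using c(1,2) by algebra+
  moreover have "w $ 1 \<noteq> 0 \<or> w $ 2 \<noteq> 0"
    using assms(3) by (auto simp: vec_eq_iff forall_2)
  ultimately have "a $ 1 * b $ 2 - a $ 2 * b $ 1 = 0"
    by auto
  then have "(a $ 1 * b $ 1 + a $ 2 * b $ 2)\<^sup>2 = 4"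
  proof -
    have "(a $ 1 * b $ 1 + a $ 2 * b $ 2)\<^sup>2
        = (a $ 1 * a $ 1 + a $ 2 * a $ 2) * (b $ 1 * b $ 1 + b $ 2 * b $ 2)
          - (a $ 1 * b $ 2 - a $ 2 * b $ 1)\<^sup>2"
      by algebra
    then show ?thesis
      using \<open>a $ 1 * b $ 2 - a $ 2 * b $ 1 = 0\<close> c(3,4) by simp
  qed
  then have "(a \<bullet> b - 2) * (a \<bullet> b + 2) = 0"
    by (simp add: inner_vec_def sum_2 power2_eq_square algebra_simps)
  moreover have "(a - b) \<bullet> (a - b) = 4 - 2 * (a \<bullet> b)" "(a + b) \<bullet> (a + b) = 4 + 2 * (a \<bullet> b)"
    using assms(4,5) by (simp_all add: inner_diff_left inner_diff_right inner_add_left inner_add_right inner_commute)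
  ultimately have "(a - b) \<bullet> (a - b) = 0 \<or> (a + b) \<bullet> (a + b) = 0"
    by auto
  then have "a - b = 0 \<or> a + b = 0"
    by (simp only: inner_eq_zero_iff)
  then show ?thesis by (auto simp: eq_neg_iff_add_eq_0)
qed

lemma affine_fun_unique:
  assumes "aff_form f f = 2" "aff_form g g = 2" "P \<noteq> Q"
    and "aff_eval f P = 0" "aff_eval f Q = 0" "aff_eval f R < 0"
    and "aff_eval g P = 0" "aff_eval g Q = 0" "aff_eval g R < 0"
  shows "f = g"
proof -
  obtain a c b c' where [simp]: "f = (a, c)" "g = (b, c')" by (metis surj_pair)
  have "a = b \<or> a = - b"
    by (rule unit_normal_unique[of _ "Q - P"])
      (use assms in \<open>auto simp: aff_form_def aff_eval_def inner_diff_right\<close>)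
  then show ?thesis
    using assms by (auto simp: aff_eval_def)
qed

lemma centroid_mem_interior:
  fixes X Y Z :: "real ^ 2"
  assumes "\<not> collinear {X, Y, Z}"
  shows "(1/3) *\<^sub>R X + (1/3) *\<^sub>R Y + (1/3) *\<^sub>R Z \<in> interior (convex hull {X, Y, Z})"
proof -
  have "interior (convex hull {X, Y, Z}) = {v. \<exists>x y z. 0 < x \<and> 0 < y \<and> 0 < z \<and> x + y + z = 1
      \<and> x *\<^sub>R X + y *\<^sub>R Y + z *\<^sub>R Z = v}"
    by (rule interior_convex_hull_3_minimal) (use assms in simp_all)
  then show ?thesis
    by (auto intro!: exI[of _ "1/3::real"])
qed

text \<open>The centroid is an interior point, and an affine function takes the mean value of the three
  vertices there. If two of these values vanish, the sign at the third vertex follows.\<close>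

lemma negative_at_opposite_vertex:
  assumes "\<not> collinear {X, Y, Z}" and "interior (convex hull {X, Y, Z}) \<subseteq> half_plane f"
    and "aff_eval f X + aff_eval f Y + aff_eval f Z = s"
  shows "s < 0"
proof -
  have "aff_eval f ((1/3) *\<^sub>R X + (1/3) *\<^sub>R Y + (1/3) *\<^sub>R Z) < 0"
    using centroid_mem_interior[OF assms(1)] assms(2) by (auto simp: half_plane_def)
  moreover have "aff_eval f ((1/3) *\<^sub>R X + (1/3) *\<^sub>R Y + (1/3) *\<^sub>R Z)
      = (aff_eval f X + aff_eval f Y + aff_eval f Z) / 3"
    by (simp add: aff_eval_def inner_add_right)
  ultimately show ?thesis using assms(3) by simp
qed

lemma mem_affine_hull_2:
  assumes "G \<in> affine hull {P, Q}"
  obtains t where "G = P + t *\<^sub>R (Q - P)"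
proof -
  have "affine hull {P, Q} = {P + t *\<^sub>R (Q - P) | t. t \<in> UNIV}"
    using affine_hull_2_alt[of P Q] by (auto simp: image_def)
  then show ?thesis using assms that by auto
qed

text \<open>With the base \<open>XY\<close> of length \<open>2 * h\<close>, both feet have distance \<open>h\<close> from the midpoint \<open>F\<close> of
  the base: \<open>G\<close> lies on Thales' circle over \<open>XY\<close>. Hence the triangle \<open>F Y G\<close> is isosceles, and
  the belt line makes the angle \<open>\<alpha>\<close> with the base. In the frame of the belt line the outward
  normals of the sides then have the angles \<open>\<alpha> + pi\<close>, \<open>\<alpha> - n * \<alpha>\<close> and \<open>pi - n * \<alpha>\<close>. The vectors
  of the seed are determined by their zero lines up to sign, and the sign by the triangle; the
  matrix is determined up to signs by the vectors, and the signs are prescribed.\<close>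

lemma initial_seed_belt_seed:
  fixes n :: nat and X Y Z F G :: "real ^ 2" and x0 :: labelled_seed
  assumes "n \<ge> 1"
    and "initial_triangle n X Y Z"
    and "initial_seed X Y Z x0"
    and "altitude_foot Z X Y F"
    and "altitude_foot X Y Z G"
  obtains e d \<kappa> h where "belt e d \<kappa> h" "G = F + h *\<^sub>R e"
    "x0 = belt.belt_seed F e d \<kappa> 1 (pi / real (2 * n + 1)) (real n * (pi / real (2 * n + 1))) 0"
proof -
  define \<alpha> where "\<alpha> = pi / real (2 * n + 1)"
  define N where "N = real n * \<alpha>"
  have N\<alpha>: "2 * N = pi - \<alpha>"
    by (simp add: N_def \<alpha>_def field_simps)
  have \<alpha>0: "0 < \<alpha>" and \<alpha>3: "\<alpha> \<le> pi / 3"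
    using assms(1) by (auto simp: \<alpha>_def field_simps)
  then have N0: "0 < N" "N < pi / 2" using N\<alpha> pi_gt_zero by linarith+
  have cN: "cos N > 0" using N0 by (intro cos_gt_zero_pi) auto
  have sN: "sin N > 0" using N0 by (intro sin_gt_zero) auto
  have s\<alpha>: "sin \<alpha> > 0" using \<alpha>0 \<alpha>3 pi_gt_zero by (intro sin_gt_zero) linarith+
  have ncol: "\<not> collinear {X, Y, Z}" and dXY: "dist X Z = dist Y Z" and ang: "angle_at X Y Z = N"
    using assms(2) by (auto simp: initial_triangle_def Let_def N_def \<alpha>_def)
  have XY: "X \<noteq> Y" and YZ: "Y \<noteq> Z" and XZ: "X \<noteq> Z"
    using ncol by (metis collinear_2 insert_absorb2 insert_commute)+

  obtain s where s: "F = X + s *\<^sub>R (Y - X)"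
    using assms(4) mem_affine_hull_2 unfolding altitude_foot_def by blast
  have Forth: "(Z - F) \<bullet> (Y - X) = 0" using assms(4) by (simp add: altitude_foot_def)
  have F: "F = X + (1/2) *\<^sub>R (Y - X)"
  proof -
    have "(X - Z) \<bullet> (X - Z) = (Y - Z) \<bullet> (Y - Z)"
      using dXY by (simp add: dist_norm norm_eq)
    then have "(Y - X) \<bullet> (Y - X) = 2 * ((Z - X) \<bullet> (Y - X))"
      by (simp add: inner_diff_left inner_diff_right inner_commute)
    moreover have "(Z - X) \<bullet> (Y - X) = s * ((Y - X) \<bullet> (Y - X))"
    proof -
      have "Z - F = Z - X - s *\<^sub>R (Y - X)" by (simp add: s)
      then show ?thesis using Forth by (simp only: inner_diff_left[of "Z - X"] inner_scaleR_left)
    qed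
    ultimately have "(1 - 2 * s) * ((Y - X) \<bullet> (Y - X)) = 0"
      by (simp only: left_diff_distrib)
    then have "s = 1 / 2" using XY by simp
    then show ?thesis using s by simp
  qed

  define h where "h = norm (Y - X) / 2"
  define H where "H = norm (Z - F)"
  define u where "u = (1 / (2 * h)) *\<^sub>R (Y - X)"
  define u' where "u' = (1 / H) *\<^sub>R (Z - F)"
  have h0: "h > 0" using XY by (simp add: h_def)
  have ZF: "Z \<noteq> F"
  proof
    assume "Z = F"
    then have "Z \<in> affine hull {X, Y}" using assms(4) by (simp add: altitude_foot_def)
    then have "collinear {X, Y, Z}"
      using XY by (metis collinear_3_affine_hull)
    then show False using ncol by simp
  qed
  then have H0: "H > 0" by (simp add: H_def)
  have uu: "u \<bullet> u = 1"
    using h0 by (simp add: u_def h_def dot_square_norm power2_eq_square)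
  have uu': "u' \<bullet> u' = 1" using H0 by (simp add: u'_def H_def dot_square_norm power2_eq_square)
  have u0: "u \<bullet> u' = 0" using Forth by (simp add: u_def u'_def inner_commute)
  have hu: "h *\<^sub>R u = (1/2) *\<^sub>R (Y - X)" using h0 by (simp add: u_def)
  have X: "X = F - h *\<^sub>R u" by (simp add: F hu)
  have Y: "Y = F + h *\<^sub>R u"
  proof -
    have "F + h *\<^sub>R u = X + ((1/2) *\<^sub>R (Y - X) + (1/2) *\<^sub>R (Y - X))" by (simp add: F hu)
    also have "\<dots> = Y" by (simp only: scaleR_half_double scaleR_add_left[symmetric]) simp
    finally show ?thesis by simp
  qed
  have Z: "Z = F + H *\<^sub>R u'" using H0 by (simp add: u'_def)
  have YX: "Y - X = (2 * h) *\<^sub>R u" using h0 by (simp add: u_def)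
  have ZX: "Z - X = h *\<^sub>R u + H *\<^sub>R u'" by (simp add: X Z)
  have ZY: "Z - Y = H *\<^sub>R u' - h *\<^sub>R u" by (simp add: Y Z)

  define \<rho> where "\<rho> = sqrt (h\<^sup>2 + H\<^sup>2)"
  have \<rho>0: "\<rho> > 0" using h0 by (simp add: \<rho>_def add_pos_nonneg)
  have \<rho>2: "\<rho>\<^sup>2 = h\<^sup>2 + H\<^sup>2" by (simp add: \<rho>_def)
  have h\<rho>: "h = \<rho> * cos N"
  proof -
    have "norm (Y - X) = 2 * h" by (simp add: h_def)
    moreover have "norm (Z - X) = \<rho>"
      unfolding ZX
      by (simp add: norm_eq_sqrt_inner inner_add_left inner_add_right uu uu' u0
          inner_commute[of u' u] \<rho>_def power2_eq_square)
    moreover have "(Y - X) \<bullet> (Z - X) = 2 * h * h"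
      unfolding YX ZX by (simp add: inner_add_right uu u0)
    ultimately have "arccos (h / \<rho>) = N"
      using ang h0 by (simp add: angle_at_def)
    moreover have "h / \<rho> \<le> 1"
      using \<rho>0 h0 by (simp add: \<rho>_def real_le_rsqrt)
    moreover have "0 \<le> h / \<rho>" using h0 \<rho>0 by simp
    ultimately have "h / \<rho> = cos N" using cos_arccos[of "h / \<rho>"] by simp
    then show ?thesis using \<rho>0 by (simp add: field_simps)
  qed
  have H\<rho>: "H = \<rho> * sin N"
  proof -
    have "H\<^sup>2 = \<rho>\<^sup>2 - (\<rho> * cos N)\<^sup>2"
      using \<rho>2 h\<rho> by simp
    also have "\<dots> = (\<rho> * sin N)\<^sup>2"
      by (simp add: power_mult_distrib sin_squared_eq right_diff_distrib)
    finally show ?thesis using H0 \<rho>0 sN by (simp add: power2_eq_iff_nonneg)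
  qed

  define e where "e = cos \<alpha> *\<^sub>R u + sin \<alpha> *\<^sub>R u'"
  define d where "d = sin \<alpha> *\<^sub>R u - cos \<alpha> *\<^sub>R u'"
  have G: "G = F + h *\<^sub>R e"
  proof -
    obtain t where t: "G = Y + t *\<^sub>R (Z - Y)"
      using assms(5) mem_affine_hull_2 unfolding altitude_foot_def by blast
    have XG: "X - G = - ((2 * h) *\<^sub>R u) - t *\<^sub>R (Z - Y)"
      unfolding t YX[symmetric] by simp
    have "(X - G) \<bullet> (Z - Y) = 0" using assms(5) by (simp add: altitude_foot_def)
    then have "2 * h * h - t * (h * h + H * H) = 0"
      unfolding XG ZY
      by (simp add: inner_diff_left inner_diff_right uu uu' u0
          inner_commute[of u' u] algebra_simps)
    then have "t * \<rho>\<^sup>2 = 2 * h * h"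
      unfolding \<rho>2 unfolding power2_eq_square by simp
    then have "t * \<rho>\<^sup>2 = (2 * (cos N)\<^sup>2) * \<rho>\<^sup>2"
      unfolding h\<rho> by (simp add: power2_eq_square)
    then have t2: "t = 2 * (cos N)\<^sup>2" using \<rho>0 by simp
    have "cos \<alpha> = - cos (2 * N)" "sin \<alpha> = sin (2 * N)"
      by (simp_all add: N\<alpha>)
    then have c\<alpha>: "cos \<alpha> = 1 - 2 * (cos N)\<^sup>2" and s\<alpha>: "sin \<alpha> = 2 * sin N * cos N"
      unfolding cos_double_cos sin_double by simp_all
    have c: "h * cos \<alpha> = h - t * h"
      unfolding c\<alpha> t2 by (simp add: algebra_simps)
    have s: "h * sin \<alpha> = t * H"
      unfolding s\<alpha> t2 h\<rho> H\<rho> by (simp add: power2_eq_square)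
    have "h *\<^sub>R e = (h * cos \<alpha>) *\<^sub>R u + (h * sin \<alpha>) *\<^sub>R u'"
      by (simp add: e_def scaleR_add_right)
    then have "F + h *\<^sub>R e = F + h *\<^sub>R u + t *\<^sub>R (H *\<^sub>R u' - h *\<^sub>R u)"
      unfolding c s by (simp add: scaleR_diff_right scaleR_diff_left)
    then show ?thesis
      by (simp add: t ZY) (simp add: Y)
  qed
  \<comment> \<open>The unit of length for which the offsets of \<open>XZ\<close> and \<open>YZ\<close> become \<open>cos N / sin \<alpha>\<close>.\<close>
  define \<kappa> where "\<kappa> = h * sin N * sin \<alpha> / cos N"
  have \<kappa>0: "\<kappa> > 0" using h0 sN s\<alpha> cN by (simp add: \<kappa>_def)
  have eu: "e \<bullet> u = cos \<alpha>" "e \<bullet> u' = sin \<alpha>" "d \<bullet> u = sin \<alpha>" "d \<bullet> u' = - cos \<alpha>"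
    by (simp_all add: e_def d_def inner_add_left inner_diff_left uu uu' u0 inner_commute[of u' u])
  have orth: "e \<bullet> e = 1" "d \<bullet> d = 1" "e \<bullet> d = 0"
  proof -
    show "e \<bullet> e = 1"
      by (subst e_def) (simp add: inner_add_right eu flip: power2_eq_square)
    show "d \<bullet> d = 1"
      by (subst (2) d_def) (simp add: inner_diff_right eu flip: power2_eq_square)
    show "e \<bullet> d = 0"
      by (subst d_def) (simp add: inner_diff_right eu)
  qed
  interpret belt F e d \<kappa> h
    by unfold_locales (use \<kappa>0 h0 orth in auto)

  have un: "unit_normal 1 \<theta> \<bullet> u = sin (\<theta> - \<alpha>)" "unit_normal 1 \<theta> \<bullet> u' = cos (\<theta> - \<alpha>)" for \<theta>
    by (simp_all add: unit_normal_def inner_diff_left eu sin_diff cos_diff)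
  have evF: "aff_eval (side 1 \<theta> w) (F + p) = sqrt 2 * (unit_normal 1 \<theta> \<bullet> p - \<kappa> * w)" for \<theta> w p
    by (simp add: aff_eval_def side_def inner_add_right algebra_simps)
  have evX: "aff_eval (side 1 \<theta> w) X = sqrt 2 * (- (h * sin (\<theta> - \<alpha>)) - \<kappa> * w)" for \<theta> w
    using evF[of \<theta> w "- (h *\<^sub>R u)"] X by (simp add: un)
  have evY: "aff_eval (side 1 \<theta> w) Y = sqrt 2 * (h * sin (\<theta> - \<alpha>) - \<kappa> * w)" for \<theta> w
    using evF[of \<theta> w "h *\<^sub>R u"] Y by (simp add: un)
  have evZ: "aff_eval (side 1 \<theta> w) Z = sqrt 2 * (H * cos (\<theta> - \<alpha>) - \<kappa> * w)" for \<theta> w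
    using evF[of \<theta> w "H *\<^sub>R u'"] Z by (simp add: un)
  note ev = evX evY evZ
  have HN: "H * cos N = h * sin N" by (simp add: h\<rho> H\<rho>)
  have \<kappa>w: "\<kappa> * (cos N / sin \<alpha>) = h * sin N"
    using cN s\<alpha> by (simp add: \<kappa>_def)

  obtain v B where x0: "x0 = (v, B)" by (metis surj_pair)
  have seed: "exchange_matrix B" "\<And>i. aff_form (v i) (v i) = 2"
      "\<And>i j. i \<noteq> j \<Longrightarrow> \<bar>aff_form (v i) (v j)\<bar> = \<bar>B $ i $ j\<bar>"
    using assms(3) by (auto simp: initial_seed_def is_seed_def x0 geometric_realisation_def)
  have dom: "(\<Inter>i. half_plane (v i)) = interior (convex hull {X, Y, Z})"
    and lines: "zero_line (v 1) = affine hull {X, Y}" "zero_line (v 2) = affine hull {X, Z}"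
      "zero_line (v 3) = affine hull {Y, Z}"
    and Bpos: "B $ 1 $ 2 > 0" "B $ 1 $ 3 > 0" "B $ 2 $ 3 > 0"
    using assms(3) by (auto simp: initial_seed_def x0)
  have inc: "interior (convex hull {X, Y, Z}) \<subseteq> half_plane (v i)" for i
    unfolding dom[symmetric] by blast
  have zero: "aff_eval (v 1) X = 0" "aff_eval (v 1) Y = 0" "aff_eval (v 2) X = 0" "aff_eval (v 2) Z = 0"
      "aff_eval (v 3) Y = 0" "aff_eval (v 3) Z = 0"
    using hull_subset[of "{X, Y}" affine] hull_subset[of "{X, Z}" affine] hull_subset[of "{Y, Z}" affine]
    unfolding lines[symmetric] zero_line_def by simp_all
  have neg: "aff_eval (v 1) Z < 0" "aff_eval (v 2) Y < 0" "aff_eval (v 3) X < 0"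
    using negative_at_opposite_vertex[OF ncol inc refl, of 1]
      negative_at_opposite_vertex[OF ncol inc refl, of 2]
      negative_at_opposite_vertex[OF ncol inc refl, of 3] zero by simp_all
  have form2: "aff_form (side 1 \<theta> w) (side 1 \<theta> w) = 2" for \<theta> w
    by (simp add: aff_form_side)
  have cN2: "cos (\<alpha> + N) = - cos N"
  proof -
    have "\<alpha> + N = pi - N" using N\<alpha> by simp
    then show ?thesis by (simp only: cos_pi_minus)
  qed
  have v1: "v 1 = side 1 (\<alpha> + pi) 0"
  proof (rule affine_fun_unique[OF seed(2) form2 XY zero(1,2) neg(1)])
    have "\<alpha> + pi - \<alpha> = pi" by simp
    then show "aff_eval (side 1 (\<alpha> + pi) 0) X = 0" "aff_eval (side 1 (\<alpha> + pi) 0) Y = 0"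
      "aff_eval (side 1 (\<alpha> + pi) 0) Z < 0"
      using H0 unfolding ev by simp_all
  qed
  have v2: "v 2 = side 1 (\<alpha> - N) (cos N / sin \<alpha>)"
  proof (rule affine_fun_unique[OF seed(2) form2 XZ zero(3,4) neg(2)])
    have "\<alpha> - N - \<alpha> = - N" by simp
    then show "aff_eval (side 1 (\<alpha> - N) (cos N / sin \<alpha>)) X = 0"
      "aff_eval (side 1 (\<alpha> - N) (cos N / sin \<alpha>)) Z = 0"
      "aff_eval (side 1 (\<alpha> - N) (cos N / sin \<alpha>)) Y < 0"
      using h0 sN unfolding ev \<kappa>w by (simp_all add: HN mult_less_0_iff)
  qed
  have v3: "v 3 = side 1 (pi - N) (cos N / sin \<alpha>)"
  proof (rule affine_fun_unique[OF seed(2) form2 YZ zero(5,6) neg(3)])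
    have eq: "pi - N - \<alpha> = N" using N\<alpha> by simp
    show "aff_eval (side 1 (pi - N) (cos N / sin \<alpha>)) Y = 0"
      "aff_eval (side 1 (pi - N) (cos N / sin \<alpha>)) Z = 0"
      "aff_eval (side 1 (pi - N) (cos N / sin \<alpha>)) X < 0"
      using h0 sN unfolding ev \<kappa>w eq by (simp_all add: HN mult_less_0_iff)
  qed
  have skew: "B $ j $ i = - B $ i $ j" for i j
  proof -
    have "transpose B $ i $ j = (- B) $ i $ j"
      using seed(1) unfolding exchange_matrix_def by (rule arg_cong)
    then show ?thesis by (simp add: transpose_def)
  qed
  have B12: "B $ 1 $ 2 = 2 * cos N"
  proof -
    have "\<alpha> + pi - (\<alpha> - N) = N + pi" by simp
    then have "aff_form (v 1) (v 2) = - 2 * cos N" by (simp add: v1 v2 aff_form_side)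
    then show ?thesis using seed(3)[of 1 2] Bpos cN by simp
  qed
  have B13: "B $ 1 $ 3 = 2 * cos N"
  proof -
    have "\<alpha> + pi - (pi - N) = \<alpha> + N" by simp
    then have "aff_form (v 1) (v 3) = - 2 * cos N" by (simp add: v1 v3 aff_form_side cN2)
    then show ?thesis using seed(3)[of 1 3] Bpos cN by simp
  qed
  have B23: "B $ 2 $ 3 = 2 * cos \<alpha>"
  proof -
    have "\<alpha> - N - (pi - N) = - (pi - \<alpha>)" by simp
    then have "aff_form (v 2) (v 3) = - 2 * cos \<alpha>"
      unfolding v2 v3 by (simp only: aff_form_side mult_1 cos_minus cos_pi_minus)
    moreover have "cos \<alpha> > 0" using \<alpha>0 \<alpha>3 pi_gt_zero by (intro cos_gt_zero_pi) linarith+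
    ultimately show ?thesis using seed(3)[of 2 3] Bpos by simp
  qed
  have Bdiag: "B $ i $ i = 0" for i
    using skew[of i i] by linarith
  have Blow: "B $ 2 $ 1 = - 2 * cos N" "B $ 3 $ 1 = - 2 * cos N" "B $ 3 $ 2 = - 2 * cos \<alpha>"
    using skew[of 1 2] skew[of 1 3] skew[of 2 3] B12 B13 B23 by simp_all
  have "x0 = belt_seed 1 \<alpha> N 0"
    unfolding x0 belt_seed_def triple_def
    by (simp add: fun_eq_iff forall_3 vec_eq_iff v1 v2 v3 B12 B13 B23 Bdiag Blow cN2)
  then show thesis
    using that[of e d \<kappa> h] G belt_axioms by (simp add: \<alpha>_def N_def)
qed


section \<open>Integer polynomials at a root of unity\<close>

definition ev :: "int poly \<Rightarrow> complex \<Rightarrow> complex" where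
  "ev P z = poly (map_poly of_int P) z"

lemma ev_pCons: "ev (pCons a P) z = of_int a + z * ev P z"
  by (simp add: ev_def map_poly_pCons)

lemma ev_0 [simp]: "ev 0 z = 0"
  by (simp add: ev_def)

lemma ev_1 [simp]: "ev 1 z = 1"
  by (simp add: ev_def)

lemma ev_add: "ev (P + Q) z = ev P z + ev Q z"
proof -
  have "map_poly of_int (P + Q) = (map_poly of_int P + map_poly of_int Q :: complex poly)"
    by (rule poly_eqI) (simp add: coeff_map_poly)
  then show ?thesis by (simp add: ev_def)
qed

lemma ev_smult: "ev (smult a P) z = of_int a * ev P z"
  by (induction P) (simp_all add: ev_pCons algebra_simps)

lemma ev_minus: "ev (- P) z = - ev P z"
  using ev_smult[of "- 1" P z] by simp

lemma ev_diff: "ev (P - Q) z = ev P z - ev Q z"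
  using ev_add[of P "- Q" z] by (simp add: ev_minus)

lemma ev_mult: "ev (P * Q) z = ev P z * ev Q z"
  by (induction P) (simp_all add: ev_pCons ev_add ev_smult algebra_simps)

lemma ev_power: "ev (P ^ n) z = ev P z ^ n"
  by (induction n) (simp_all add: ev_mult)

lemma ev_sum: "ev (sum f A) z = (\<Sum>i\<in>A. ev (f i) z)"
  by (induction A rule: infinite_finite_induct) (simp_all add: ev_add)

lemma ev_monom: "ev (monom a n) z = of_int a * z ^ n"
  by (simp add: ev_def map_poly_monom poly_monom)

lemma ev_pcompose_monom: "ev (pcompose P (monom 1 j)) z = ev P (z ^ j)"
  by (induction P) (simp_all add: pcompose_pCons ev_add ev_mult ev_pCons ev_monom)

lemma prime_dvd_freshmans_dream:
  fixes a b :: "'a :: comm_ring_1"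
  assumes "prime p"
  shows "of_nat p dvd (a + b) ^ p - a ^ p - b ^ p"
proof -
  have p: "p > 0" using assms prime_gt_0_nat by simp
  have "(a + b) ^ p = (\<Sum>k\<le>p. of_nat (p choose k) * a ^ k * b ^ (p - k))"
    by (rule binomial_ring)
  also have "\<dots> = (\<Sum>k\<in>{0, p}. of_nat (p choose k) * a ^ k * b ^ (p - k))
      + (\<Sum>k\<in>{..p} - {0, p}. of_nat (p choose k) * a ^ k * b ^ (p - k))"
    by (subst sum.subset_diff[of "{0, p}"]) (auto simp: add.commute)
  also have "(\<Sum>k\<in>{0, p}. of_nat (p choose k) * a ^ k * b ^ (p - k)) = a ^ p + b ^ p"
    using p by simp
  finally have "(a + b) ^ p - a ^ p - b ^ p
      = (\<Sum>k\<in>{..p} - {0, p}. of_nat (p choose k) * a ^ k * b ^ (p - k))"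
    by simp
  moreover have "of_nat p dvd (\<Sum>k\<in>{..p} - {0, p}. of_nat (p choose k) * a ^ k * b ^ (p - k))"
  proof (rule dvd_sum)
    fix k assume k: "k \<in> {..p} - {0, p}"
    have "p dvd (p choose k)"
      by (rule dvd_choose_prime) (use k assms in auto)
    then have "(of_nat p :: 'a) dvd of_nat (p choose k)"
      by (metis dvdE dvdI of_nat_mult)
    then show "of_nat p dvd of_nat (p choose k) * a ^ k * b ^ (p - k)"
      by (simp add: mult.assoc)
  qed
  ultimately show ?thesis by simp
qed

lemma prime_dvd_power_minus_self:
  fixes a :: int
  assumes "prime p"
  shows "int p dvd a ^ p - a"
proof (induction a rule: int_induct[where k = 0])
  case base
  then show ?case using assms prime_gt_0_nat[of p] by (simp add: power_0_left)
next
  case (step1 i)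
  have "(i + 1) ^ p - (i + 1) = ((i + 1) ^ p - i ^ p - 1 ^ p) + (i ^ p - i)" by simp
  then show ?case
    using prime_dvd_freshmans_dream[OF assms, of i 1] step1 by (metis dvd_add of_nat_id of_int_of_nat_eq)
next
  case (step2 i)
  have "(i - 1) ^ p - (i - 1) = (i ^ p - i) - (((i - 1) + 1) ^ p - (i - 1) ^ p - 1 ^ p)" by simp
  then show ?case
    using prime_dvd_freshmans_dream[OF assms, of "i - 1" 1] step2 by (metis dvd_diff)
qed

text \<open>Modulo \<open>p\<close> the map \<open>P \<mapsto> P ^ p\<close> is additive and fixes constants, so it only replaces the
  variable by its \<open>p\<close>-th power.\<close>

lemma frobenius_congruence:
  fixes P :: "int poly"
  assumes "prime p"
  shows "[:int p:] dvd pcompose P (monom 1 p) - P ^ p"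
proof (induction P)
  case 0
  then show ?case using assms prime_gt_0_nat[of p] by (simp add: power_0_left)
next
  case (pCons a P)
  have c: "(of_nat p :: int poly) = [:int p:]" by (simp add: of_nat_poly)
  have "pCons a P = [:a:] + [:0, 1:] * P" by simp
  then have 1: "[:int p:] dvd (pCons a P) ^ p - [:a:] ^ p - ([:0, 1:] * P) ^ p"
    using prime_dvd_freshmans_dream[OF assms, of "[:a:]" "[:0, 1:] * P"] unfolding c by metis
  have 2: "[:int p:] dvd [:a ^ p - a:]"
  proof -
    obtain c where "a ^ p - a = int p * c"
      using prime_dvd_power_minus_self[OF assms, of a] by (elim dvdE)
    then have "[:a ^ p - a:] = [:int p:] * [:c:]" by simp
    then show ?thesis by (rule dvdI)
  qed
  have 3: "[:int p:] dvd monom 1 p * (pcompose P (monom 1 p) - P ^ p)"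
    using pCons.IH by simp
  have m: "monom 1 p = [:0, 1:] ^ p" for p
    by (simp add: monom_altdef)
  have e1: "pcompose (pCons a P) (monom 1 p) = [:a:] + monom 1 p * pcompose P (monom 1 p)"
    by (simp add: pcompose_pCons)
  have e2: "([:0, 1:] * P) ^ p = monom 1 p * P ^ p"
    by (simp only: m power_mult_distrib)
  have e3: "[:a ^ p - a:] = [:a:] ^ p - [:a:]" by (simp add: poly_const_pow)
  have "(u + t * v) - w = - (w - y - t * z) - (y - u) + t * (v - z)" for u t v w y z :: "int poly"
    by (simp add: algebra_simps)
  from this[of "[:a:]" "monom 1 p" "pcompose P (monom 1 p)" "(pCons a P) ^ p" "[:a:] ^ p" "P ^ p"]
  have "pcompose (pCons a P) (monom 1 p) - (pCons a P) ^ p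
    = - ((pCons a P) ^ p - [:a:] ^ p - ([:0, 1:] * P) ^ p) - [:a ^ p - a:]
      + monom 1 p * (pcompose P (monom 1 p) - P ^ p)"
    by (simp only: e1 e2 e3)
  then show ?case
    using 1 2 3 by (metis dvd_add dvd_diff dvd_minus_iff)
qed

text \<open>Adding to \<open>k\<close> the product of \<open>q\<close> and of all small primes which do not divide \<open>k\<close> destroys
  all small prime factors: a small prime that divides \<open>k\<close> divides neither \<open>q\<close> nor this product.\<close>

lemma exists_coprime_shift:
  fixes k q A :: nat
  assumes "coprime k q" "q > 0"
  obtains k' where "[k' = k] (mod q)" "k' > 0" "\<And>p. prime p \<Longrightarrow> p dvd k' \<Longrightarrow> p > A"
proof -
  define S where "S = {p. prime p \<and> p \<le> A \<and> \<not> p dvd k}"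
  have fin: "finite S" by (rule finite_subset[of _ "{..A}"]) (auto simp: S_def)
  have pos: "\<Prod>S > 0" by (rule prod_pos) (auto simp: S_def prime_gt_0_nat)
  define k' where "k' = k + q * \<Prod>S"
  show ?thesis
  proof (rule that[of k'])
    show "[k' = k] (mod q)" by (simp add: k'_def cong_def)
    show "k' > 0" using pos assms(2) by (simp add: k'_def)
    show "p > A" if p: "prime p" "p dvd k'" for p
    proof (rule ccontr)
      assume "\<not> p > A"
      show False
      proof (cases "p dvd k")
        case True
        then have "p dvd q * \<Prod>S" using p(2) by (simp add: k'_def dvd_add_right_iff)
        moreover have "\<not> p dvd q"
          using True assms(1) p(1) by (metis coprime_common_divisor not_prime_unit)
        ultimately have "p dvd \<Prod>S" using p(1) by (simp add: prime_dvd_mult_iff)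
        then obtain r where "r \<in> S" "p dvd r" using p(1) fin by (auto simp: prime_dvd_prod_iff)
        moreover from this have "p = r" using p(1) by (auto simp: S_def intro: primes_dvd_imp_eq)
        ultimately show False using True by (auto simp: S_def)
      next
        case False
        then have "p \<in> S" using p(1) \<open>\<not> p > A\<close> by (simp add: S_def)
        then have "p dvd \<Prod>S" using fin dvd_prodI[of S p "\<lambda>x. x"] by simp
        then have "p dvd q * \<Prod>S" by simp
        then show False using False p(2) by (simp add: k'_def dvd_add_left_iff)
      qed
    qed
  qed
qed

text \<open>This is Landau's proof that the primitive \<open>q\<close>-th roots of unity are conjugate. All values
  \<open>P(z ^ j)\<close> have, after multiplication by a fixed integer \<open>L ^ q\<close>, unique representations \<open>r j\<close>
  as integer polynomials in \<open>z\<close> of degree below the minimal degree \<open>d\<close> of a relation for \<open>z\<close>, and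
  there are only finitely many of them because \<open>z ^ q = 1\<close>. If \<open>P(z ^ j) = 0\<close> and \<open>p\<close> is prime,
  then \<open>P(z ^ (j * p))\<close> is divisible by \<open>p\<close>, by the Frobenius congruence. When \<open>p\<close> exceeds all
  coefficients that occur, it must be zero. Finally every residue class prime to \<open>q\<close> contains a
  number with large prime factors only.\<close>

theorem ev_conjugate_eq_0:
  fixes P :: "int poly" and z :: complex
  assumes "z ^ q = 1" "q > 0" "coprime k q" "ev P z = 0"
  shows "ev P (z ^ k) = 0"
proof -
  define f0 :: "int poly" where "f0 = monom 1 q - 1"
  have f0: "ev f0 z = 0" by (simp add: f0_def ev_diff ev_monom assms(1))
  have f0_lead: "degree f0 = q" "lead_coeff f0 = 1" "f0 \<noteq> 0"
  proof -
    show d: "degree f0 = q"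
      unfolding f0_def diff_conv_add_uminus using assms(2)
      by (subst degree_add_eq_left) (simp_all add: degree_monom_eq)
    show "lead_coeff f0 = 1" unfolding d using assms(2) by (simp add: f0_def)
    then show "f0 \<noteq> 0" by auto
  qed
  define d where "d = (LEAST d. \<exists>f :: int poly. f \<noteq> 0 \<and> ev f z = 0 \<and> degree f = d)"
  have "\<exists>f :: int poly. f \<noteq> 0 \<and> ev f z = 0 \<and> degree f = d"
    unfolding d_def by (rule LeastI_ex) (use f0 f0_lead in blast)
  then obtain f where f: "f \<noteq> 0" "ev f z = 0" "degree f = d" by blast
  have min: "g = 0" if "ev g z = 0" "degree g < d" for g
    using not_less_Least that unfolding d_def by blast
  have d0: "d > 0"
  proof (rule ccontr)
    assume "\<not> d > 0"
    then obtain a where "f = [:a:]" using f(3) degree_eq_zeroE by auto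
    then show False using f(1,2) by (simp add: ev_pCons)
  qed
  define L where "L = lead_coeff f"
  have L: "L \<noteq> 0" using f(1) by (simp add: L_def)
  have red: "\<exists>r. degree r < d \<and> of_int L ^ q * ev R z = ev r z" for R
  proof -
    obtain Q1 R1 where R1: "pseudo_divmod R f0 = (Q1, R1)" by fastforce
    have "R = f0 * Q1 + R1" and dR1: "R1 = 0 \<or> degree R1 < q"
      using pseudo_divmod[OF f0_lead(3) R1] f0_lead by simp_all
    then have R: "ev R z = ev R1 z" by (simp add: ev_add ev_mult f0)
    obtain Q2 R2 where R2: "pseudo_divmod R1 f = (Q2, R2)" by fastforce
    define m where "m = Suc (degree R1) - d"
    have "smult (L ^ m) R1 = f * Q2 + R2" and dR2: "R2 = 0 \<or> degree R2 < d"
      using pseudo_divmod[OF f(1) R2] f(3) by (simp_all add: L_def m_def)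
    then have "ev (smult (L ^ m) R1) z = ev (f * Q2 + R2) z" by simp
    then have "of_int L ^ m * ev R1 z = ev R2 z"
      by (simp add: ev_add ev_mult f ev_smult)
    moreover have "m \<le> q" using dR1 assms(2) d0 by (auto simp: m_def)
    ultimately have "of_int L ^ q * ev R z = ev (smult (L ^ (q - m)) R2) z"
      unfolding R ev_smult by (metis ab_semigroup_mult_class.mult_ac(1) le_add_diff_inverse2 of_int_power power_add)
    moreover have "degree (smult (L ^ (q - m)) R2) < d"
      using dR2 d0 degree_smult_le[of "L ^ (q - m)" R2] by auto
    ultimately show ?thesis by metis
  qed
  have uniq: "r = s" if "degree r < d" "degree s < d" "ev r z = ev s z" for r s
    using min[of "r - s"] that degree_diff_less[of r d s] by (simp add: ev_diff)
  have "\<forall>j. \<exists>r. degree r < d \<and> of_int L ^ q * ev P (z ^ j) = ev r z"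
    using red[of "pcompose P (monom 1 j)" for j] by (simp add: ev_pcompose_monom)
  then obtain r where r: "\<And>j. degree (r j) < d" "\<And>j. of_int L ^ q * ev P (z ^ j) = ev (r j) z"
    by metis
  have zmod: "z ^ j = z ^ (j mod q)" for j
  proof -
    have "z ^ j = z ^ (q * (j div q) + j mod q)" by simp
    then show ?thesis by (simp only: power_add power_mult assms(1)) simp
  qed
  have rmod: "r j = r (j mod q)" for j
    by (rule uniq[OF r(1) r(1)]) (use r(2) zmod[of j] in metis)
  define A where "A = (\<Sum>j<q. \<Sum>i<d. \<bar>coeff (r j) i\<bar>)"
  have A: "\<bar>coeff (r j) i\<bar> \<le> A" for i j
  proof (cases "i < d")
    case True
    have "\<bar>coeff (r (j mod q)) i\<bar> \<le> (\<Sum>i<d. \<bar>coeff (r (j mod q)) i\<bar>)"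
      by (rule member_le_sum[of i]) (use True in auto)
    also have "\<dots> \<le> A"
      unfolding A_def
      by (rule member_le_sum[of "j mod q" _ "\<lambda>j. \<Sum>i<d. \<bar>coeff (r j) i\<bar>"])
        (use assms(2) in \<open>auto intro: sum_nonneg\<close>)
    finally show ?thesis using rmod[of j] by simp
  next
    case False
    then have "coeff (r j) i = 0" using r(1)[of j] by (intro coeff_eq_0) simp
    moreover have "A \<ge> 0" unfolding A_def by (intro sum_nonneg) auto
    ultimately show ?thesis by simp
  qed
  have step: "ev P (z ^ (j * p)) = 0" if p: "prime p" "int p > A" and 0: "ev P (z ^ j) = 0" for j p
  proof -
    define R where "R = pcompose P (monom 1 j)"
    obtain Q where "pcompose R (monom 1 p) - R ^ p = [:int p:] * Q"
      using frobenius_congruence[OF p(1), of R] by (elim dvdE)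
    then have "ev (pcompose R (monom 1 p) - R ^ p) z = ev ([:int p:] * Q) z" by simp
    then have e: "ev P (z ^ (j * p)) = of_nat p * ev Q z"
      using 0 prime_gt_0_nat[OF p(1)]
      by (simp add: ev_diff ev_pcompose_monom ev_power ev_smult R_def power_mult mult.commute power_0_left)
        (metis power_mult mult.commute)
    obtain s where s: "degree s < d" "of_int L ^ q * ev Q z = ev s z" using red by blast
    have "r (j * p) = smult (int p) s"
    proof (rule uniq[OF r(1)])
      show "degree (smult (int p) s) < d"
        using s(1) degree_smult_le[of "int p" s] by simp
      show "ev (r (j * p)) z = ev (smult (int p) s) z"
        unfolding r(2)[symmetric] e ev_smult s(2)[symmetric] by simp
    qed
    then have "coeff (r (j * p)) i = int p * coeff s i" for i by simp
    moreover have "coeff s i = 0" for i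
    proof (rule ccontr)
      assume "coeff s i \<noteq> 0"
      then have "int p * 1 \<le> int p * \<bar>coeff s i\<bar>" by (intro mult_left_mono) auto
      then show False using A[of "j * p" i] p(2) calculation[of i] by (simp add: abs_mult)
    qed
    ultimately have "r (j * p) = 0" by (intro poly_eqI) simp
    then show ?thesis using r(2)[of "j * p"] L by simp
  qed
  have many: "ev P (z ^ (j * m)) = 0"
    if "\<And>p. prime p \<Longrightarrow> p dvd m \<Longrightarrow> int p > A" "ev P (z ^ j) = 0" "m > 0" for j m
    using that
  proof (induction m arbitrary: j rule: less_induct)
    case (less m)
    show ?case
    proof (cases "m = 1")
      case True
      then show ?thesis using less.prems by simp
    next
      case False
      then obtain p where p: "prime p" "p dvd m" by (metis prime_factor_nat)
      then obtain m' where m: "m = p * m'" by (elim dvdE)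
      have "m' > 0" "m' < m" using less.prems(3) p(1) prime_gt_1_nat[of p] by (auto simp: m)
      moreover have "ev P (z ^ (j * p)) = 0" using step less.prems p by blast
      ultimately have "ev P (z ^ (j * p * m')) = 0"
        using less.IH[of m' "j * p"] less.prems(1) by (simp add: m)
      then show ?thesis by (simp add: m mult.assoc)
    qed
  qed
  obtain k' where k': "[k' = k] (mod q)" "k' > 0" "\<And>p. prime p \<Longrightarrow> p dvd k' \<Longrightarrow> p > nat A"
    using exists_coprime_shift[OF assms(3,2), of "nat A"] by blast
  have "ev P (z ^ (1 * k')) = 0"
  proof (rule many)
    show "int p > A" if "prime p" "p dvd k'" for p
      using k'(3)[OF that] by linarith
  qed (use assms k' in auto)
  moreover have "z ^ k' = z ^ k" using k'(1) zmod[of k'] zmod[of k] by (simp add: cong_def)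
  ultimately show ?thesis by simp
qed


section \<open>Counting algebraic integers with bounded conjugates\<close>

definition unity_root :: "nat \<Rightarrow> nat \<Rightarrow> complex" where
  "unity_root q k = cis (2 * pi * real k / real q)"

lemma unity_root_power: "unity_root q k ^ j = unity_root q (k * j)"
  unfolding unity_root_def Complex.DeMoivre by (simp add: mult_ac)

lemma unity_root_power_q:
  assumes "q > 0"
  shows "unity_root q k ^ q = 1"
proof -
  have "real q * (2 * pi * real k / real q) = 2 * pi * real k" using assms by simp
  then show ?thesis unfolding unity_root_def Complex.DeMoivre by (simp only: cis_multiple_2pi Ints_of_nat)
qed

lemma norm_unity_root [simp]: "cmod (unity_root q k) = 1"
  by (simp add: unity_root_def)

lemma unity_root_cancel:
  assumes "d > 0"
  shows "unity_root (d * q) (k * d) = unity_root q k"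
proof -
  have "2 * pi * real (k * d) / real (d * q) = 2 * pi * real k / real q" using assms by simp
  then show ?thesis by (simp only: unity_root_def)
qed

lemma unity_root_reflect:
  assumes "k \<le> q" "q > 0"
  shows "unity_root q (q - k) = cnj (unity_root q k)"
proof -
  have "2 * pi * real (q - k) / real q = 2 * pi + - (2 * pi * real k / real q)"
    using assms by (simp add: of_nat_diff field_simps)
  then show ?thesis
    unfolding unity_root_def by (simp only: cis_cnj cis_mult[symmetric] cis_2pi mult_1)
qed

lemma unity_root_eq_1_iff:
  assumes "q > 0"
  shows "unity_root q k = 1 \<longleftrightarrow> q dvd k"
proof
  assume "unity_root q k = 1"
  then have "cos (2 * pi * real k / real q) = 1"
    by (simp add: unity_root_def complex_eq_iff)
  then obtain i :: int where "2 * pi * real k / real q = of_int i * 2 * pi"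
    by (auto simp: cos_one_2pi_int)
  then have "real k = of_int i * real q" using assms by (simp add: field_simps)
  then have "int k = i * int q" by (metis of_int_eq_iff of_int_mult of_int_of_nat_eq)
  then show "q dvd k" by (metis dvd_triv_right int_dvd_int_iff)
next
  assume "q dvd k"
  then obtain j where "k = q * j" by (elim dvdE)
  then show "unity_root q k = 1"
    using unity_root_power_q[OF assms, of j] by (simp add: unity_root_power mult.commute)
qed

text \<open>The sum over all residues is \<open>0\<close> or \<open>q\<close>. Sorting the residues by their greatest common
  divisor with \<open>q\<close> expresses it through the sums over the primitive roots of unity of all orders
  that divide \<open>q\<close>, which gives an induction on \<open>q\<close>.\<close>

lemma ramanujan_sum_in_Ints:
  assumes "q > 0"
  shows "(\<Sum>k\<in>totatives q. unity_root q (k * m)) \<in> \<int>"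
  using assms
proof (induction q rule: less_induct)
  case (less q)
  have full: "(\<Sum>k\<in>{0<..q}. unity_root q (k * m)) \<in> \<int>"
  proof -
    let ?z = "unity_root q m"
    have eq: "(\<Sum>k\<in>{0<..q}. unity_root q (k * m)) = (\<Sum>k<q. ?z ^ Suc k)"
      by (rule sum.reindex_bij_witness[of _ Suc "\<lambda>k. k - 1"])
        (auto simp: unity_root_power mult.commute)
    have "(\<Sum>k<q. ?z ^ Suc k) = ?z * (\<Sum>k<q. ?z ^ k)"
      by (simp add: sum_distrib_left)
    also have "\<dots> \<in> \<int>"
    proof (cases "?z = 1")
      case True
      then show ?thesis by simp
    next
      case False
      then have "(\<Sum>k<q. ?z ^ k) = 0"
        using unity_root_power_q[OF less.prems, of m] by (simp add: geometric_sum)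
      then show ?thesis by simp
    qed
    finally show ?thesis unfolding eq .
  qed
  have fin: "finite {d. d dvd q}" using less.prems by simp
  let ?f = "\<lambda>d. \<Sum>k\<in>{k \<in> {0<..q}. gcd k q = d}. unity_root q (k * m)"
  have f: "?f d = (\<Sum>k\<in>totatives (q div d). unity_root (q div d) (k * m))" if d: "d dvd q" for d
  proof -
    have "d > 0" using d less.prems by (intro Nat.gr0I) auto
    have "(\<Sum>k\<in>totatives (q div d). unity_root q (k * d * m)) = ?f d"
      by (rule sum.reindex_bij_betw[OF bij_betw_totatives_gcd_eq[OF d less.prems]])
    moreover have "unity_root q (k * d * m) = unity_root (q div d) (k * m)" for k
      using unity_root_cancel[OF \<open>d > 0\<close>, of "q div d" "k * m"] d by (simp add: mult_ac)
    ultimately show ?thesis by simp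
  qed
  have "(\<Sum>k\<in>{0<..q}. unity_root q (k * m)) = (\<Sum>d\<in>{d. d dvd q}. ?f d)"
    by (rule sum.group[symmetric]) (use fin in auto)
  also have "\<dots> = ?f 1 + (\<Sum>d\<in>{d. d dvd q} - {1}. ?f d)"
    using fin by (intro sum.remove) auto
  finally have "(\<Sum>k\<in>totatives q. unity_root q (k * m))
      = (\<Sum>k\<in>{0<..q}. unity_root q (k * m)) - (\<Sum>d\<in>{d. d dvd q} - {1}. ?f d)"
    using f[of 1] by simp
  moreover have "(\<Sum>d\<in>{d. d dvd q} - {1}. ?f d) \<in> \<int>"
  proof (rule Ints_sum)
    fix d assume d: "d \<in> {d. d dvd q} - {1}"
    then have "d > 1" using less.prems by (cases "d = 0") auto
    then have "q div d < q" "q div d > 0"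
      using d less.prems dvd_imp_le[of d q] by (auto simp: div_greater_zero_iff)
    then show "?f d \<in> \<int>" using less.IH f d by simp
  qed
  ultimately show ?case using full by simp
qed

lemma trace_in_Ints:
  assumes "q > 0"
  shows "(\<Sum>k\<in>totatives q. ev R (unity_root q k)) \<in> \<int>"
proof -
  have "ev R z = (\<Sum>i\<le>degree R. of_int (coeff R i) * z ^ i)" for z
    by (subst poly_as_sum_of_monoms[symmetric]) (simp add: ev_sum ev_monom)
  then have "(\<Sum>k\<in>totatives q. ev R (unity_root q k))
      = (\<Sum>k\<in>totatives q. \<Sum>i\<le>degree R. of_int (coeff R i) * unity_root q (k * i))"
    by (simp add: unity_root_power)
  also have "\<dots> = (\<Sum>i\<le>degree R. of_int (coeff R i) * (\<Sum>k\<in>totatives q. unity_root q (k * i)))"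
    by (subst sum.swap) (simp add: sum_distrib_left)
  also have "\<dots> \<in> \<int>"
    by (intro Ints_sum Ints_mult ramanujan_sum_in_Ints assms) auto
  finally show ?thesis .
qed

lemma ev_cnj: "ev P (cnj z) = cnj (ev P z)"
  by (induction P) (simp_all add: ev_pCons)

text \<open>One representative from each pair of complex conjugate primitive \<open>q\<close>-th roots of unity.\<close>

definition half_totatives :: "nat \<Rightarrow> nat set" where
  "half_totatives q = {k \<in> totatives q. 2 * k < q}"

lemma finite_half_totatives [simp]: "finite (half_totatives q)"
  by (simp add: half_totatives_def)

lemma coprime_complement:
  fixes k q :: nat
  assumes "k \<le> q"
  shows "coprime (q - k) q \<longleftrightarrow> coprime k q"
  using assms by (simp add: coprime_iff_gcd_eq_1 gcd_diff2_nat)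

lemma totatives_cases:
  assumes "k \<in> totatives q" "q > 2"
  shows "k \<in> half_totatives q \<or> q - k \<in> half_totatives q"
proof -
  have k: "k > 0" "k \<le> q" "coprime k q" using assms(1) by (auto simp: in_totatives_iff)
  have "2 * k \<noteq> q"
  proof
    assume "2 * k = q"
    then have "k dvd q" by auto
    then have "k = 1" using k(3) by (metis coprime_common_divisor_nat dvd_refl)
    then show False using \<open>2 * k = q\<close> assms(2) by simp
  qed
  moreover have "k \<noteq> q" using k(3) assms(2) by auto
  moreover have "coprime (q - k) q" using k coprime_complement by simp
  ultimately show ?thesis
    using k by (auto simp: half_totatives_def in_totatives_iff)
qed

lemma card_half_totatives:
  assumes "q > 2"
  shows "2 * card (half_totatives q) = totient q"
proof -
  have 1: "totatives q = half_totatives q \<union> (\<lambda>k. q - k) ` half_totatives q"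
  proof (intro equalityI subsetI)
    fix k assume k: "k \<in> totatives q"
    then have "k = q - (q - k)" using totatives_le[OF k] by simp
    then show "k \<in> half_totatives q \<union> (\<lambda>k. q - k) ` half_totatives q"
      using totatives_cases[OF k assms] by blast
  next
    fix k assume "k \<in> half_totatives q \<union> (\<lambda>k. q - k) ` half_totatives q"
    then show "k \<in> totatives q"
      using assms
      by (auto simp: half_totatives_def in_totatives_iff coprime_complement)
  qed
  have "inj_on (\<lambda>k. q - k) (half_totatives q)"
    by (auto simp: inj_on_def half_totatives_def)
  moreover have "half_totatives q \<inter> (\<lambda>k. q - k) ` half_totatives q = {}"
    by (auto simp: half_totatives_def)
  ultimately have "card (totatives q) = card (half_totatives q) + card (half_totatives q)"
    unfolding 1 by (subst card_Un_disjoint) (auto simp: card_image)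
  then show ?thesis by (simp add: totient_def)
qed

definition conjugates_bounded :: "nat \<Rightarrow> real \<Rightarrow> int poly \<Rightarrow> bool" where
  "conjugates_bounded q b P \<longleftrightarrow>
     (\<forall>k\<in>totatives q. ev P (unity_root q k) \<in> \<real> \<and> cmod (ev P (unity_root q k)) \<le> b)"

text \<open>The sum of the squares of the conjugates is an integer, because it is the trace of \<open>D * D\<close>.
  As the conjugates are real and small it is less than one, hence zero, and so is each summand.\<close>

lemma ev_eq_0_if_conjugates_small:
  assumes "q > 2" "\<And>k. k \<in> totatives q \<Longrightarrow> ev D (unity_root q k) \<in> \<real>"
    and small: "\<And>k. k \<in> half_totatives q \<Longrightarrow> cmod (ev D (unity_root q k)) < 1 / real q"
  shows "ev D (unity_root q 1) = 0"
proof -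
  define x where "x k = Re (ev D (unity_root q k))" for k
  have ev: "ev D (unity_root q k) = of_real (x k)" if "k \<in> totatives q" for k
    using assms(2)[OF that] by (simp add: x_def)
  have sm: "\<bar>x k\<bar> < 1 / real q" if k: "k \<in> totatives q" for k
  proof -
    have "cmod (ev D (unity_root q k)) < 1 / real q"
      using totatives_cases[OF k assms(1)]
    proof
      assume "q - k \<in> half_totatives q"
      then have "cmod (ev D (unity_root q (q - k))) < 1 / real q" by (rule small)
      then show ?thesis
        using totatives_le[OF k] assms(1) by (simp add: unity_root_reflect ev_cnj)
    qed (rule small)
    then show ?thesis by (simp add: ev[OF k])
  qed
  have "of_real (\<Sum>k\<in>totatives q. (x k)\<^sup>2) = (\<Sum>k\<in>totatives q. ev (D * D) (unity_root q k))"
    by (simp add: ev_mult ev power2_eq_square)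
  also have "\<dots> \<in> \<int>" by (rule trace_in_Ints) (use assms in simp)
  finally obtain i :: int where "complex_of_real (\<Sum>k\<in>totatives q. (x k)\<^sup>2) = of_int i"
    by (elim Ints_cases)
  then have i: "(\<Sum>k\<in>totatives q. (x k)\<^sup>2) = of_int i"
    by (metis of_real_eq_iff of_real_of_int_eq)
  have "(\<Sum>k\<in>totatives q. (x k)\<^sup>2) \<le> (\<Sum>k\<in>totatives q. (1 / real q)\<^sup>2)"
    using sm by (intro sum_mono) (metis abs_le_square_iff abs_of_pos less_eq_real_def of_nat_0_le_iff zero_le_divide_1_iff abs_of_nonneg)
  also have "\<dots> = real (totient q) * (1 / real q)\<^sup>2" by (simp add: totient_def)
  also have "\<dots> \<le> real q * (1 / real q)\<^sup>2"
    by (intro mult_right_mono) (auto simp: totient_le)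
  also have "\<dots> < 1" using assms(1) by (simp add: power2_eq_square)
  finally have "i < 1" unfolding i by simp
  moreover have "(\<Sum>k\<in>totatives q. (x k)\<^sup>2) \<ge> 0" by (intro sum_nonneg) auto
  ultimately have "(\<Sum>k\<in>totatives q. (x k)\<^sup>2) = 0" unfolding i by simp
  then have "\<forall>k\<in>totatives q. (x k)\<^sup>2 = 0" by (subst (asm) sum_nonneg_eq_0_iff) auto
  moreover have "1 \<in> totatives q" using assms(1) by (simp add: in_totatives_iff)
  ultimately show ?thesis using ev by fastforce
qed

text \<open>Two distinct values have some conjugate in which they differ by at least \<open>1 / q\<close>. So
  rounding the conjugates to multiples of \<open>1 / (2 * q)\<close> separates the values.\<close>

lemma card_bounded_conjugates:
  fixes b :: nat
  assumes q: "q > 2"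
  defines "S \<equiv> {y :: complex. \<exists>P. conjugates_bounded q (real b) P \<and> y = ev P (unity_root q 1)}"
  shows "finite S" "card S \<le> (4 * q * b + 1) ^ card (half_totatives q)"
proof -
  have "\<forall>y\<in>S. \<exists>P. conjugates_bounded q (real b) P \<and> y = ev P (unity_root q 1)"
    by (simp add: S_def)
  then obtain p where p: "\<And>y. y \<in> S \<Longrightarrow> conjugates_bounded q (real b) (p y)"
      "\<And>y. y \<in> S \<Longrightarrow> y = ev (p y) (unity_root q 1)"
    by metis
  define g where "g y = (\<lambda>k\<in>half_totatives q. \<lfloor>2 * real q * Re (ev (p y) (unity_root q k))\<rfloor>)" for y
  let ?I = "{- int (2 * q * b) .. int (2 * q * b)}"
  have half: "k \<in> totatives q" if "k \<in> half_totatives q" for k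
    using that by (simp add: half_totatives_def)
  have gS: "g ` S \<subseteq> half_totatives q \<rightarrow>\<^sub>E ?I"
  proof (rule image_subsetI, rule PiE_I)
    fix y k assume y: "y \<in> S" and k: "k \<in> half_totatives q"
    have "\<bar>Re (ev (p y) (unity_root q k))\<bar> \<le> real b"
      using p(1)[OF y] half[OF k] abs_Re_le_cmod order_trans
      unfolding conjugates_bounded_def by blast
    then have "\<bar>2 * real q * Re (ev (p y) (unity_root q k))\<bar> \<le> 2 * real q * real b"
      by (simp add: abs_mult mult_left_mono)
    moreover have "real_of_int (int (2 * q * b)) = 2 * real q * real b" by simp
    ultimately have "2 * real q * Re (ev (p y) (unity_root q k)) \<le> of_int (int (2 * q * b))"
      "of_int (- int (2 * q * b)) \<le> 2 * real q * Re (ev (p y) (unity_root q k))"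
      unfolding of_int_minus by linarith+
    then have "\<lfloor>2 * real q * Re (ev (p y) (unity_root q k))\<rfloor> \<le> int (2 * q * b)"
      "- int (2 * q * b) \<le> \<lfloor>2 * real q * Re (ev (p y) (unity_root q k))\<rfloor>"
      by (metis floor_mono floor_of_int, simp only: le_floor_iff)
    then show "g y k \<in> ?I" using k by (simp add: g_def)
  qed (simp add: g_def)
  have inj: "inj_on g S"
  proof (rule inj_onI)
    fix y y' assume y: "y \<in> S" "y' \<in> S" and eq: "g y = g y'"
    have "ev (p y - p y') (unity_root q 1) = 0"
    proof (rule ev_eq_0_if_conjugates_small[OF q])
      show R: "ev (p y - p y') (unity_root q k) \<in> \<real>" if "k \<in> totatives q" for k
        using p(1) y that by (simp add: ev_diff conjugates_bounded_def)
      fix k assume k: "k \<in> half_totatives q"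
      have "\<lfloor>2 * real q * Re (ev (p y) (unity_root q k))\<rfloor> = \<lfloor>2 * real q * Re (ev (p y') (unity_root q k))\<rfloor>"
        using fun_cong[OF eq, of k] k by (simp add: g_def)
      then have "\<bar>2 * real q * Re (ev (p y) (unity_root q k)) - 2 * real q * Re (ev (p y') (unity_root q k))\<bar> < 1"
        by linarith
      then have "\<bar>2 * real q * Re (ev (p y - p y') (unity_root q k))\<bar> < 1"
        by (simp add: ev_diff right_diff_distrib)
      then have "\<bar>Re (ev (p y - p y') (unity_root q k))\<bar> < 1 / (2 * real q)"
        using q by (simp add: abs_mult field_simps)
      also have "\<dots> \<le> 1 / real q" using q by (simp add: field_simps)
      finally show "cmod (ev (p y - p y') (unity_root q k)) < 1 / real q"
        using R[OF half[OF k]] by (simp add: in_Reals_norm)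
    qed
    then show "y = y'" using p(2) y by (simp add: ev_diff)
  qed
  have fin: "finite (half_totatives q \<rightarrow>\<^sub>E ?I)" by (intro finite_PiE) auto
  show "finite S" using fin gS inj by (metis finite_imageD finite_subset)
  have "card S \<le> card (half_totatives q \<rightarrow>\<^sub>E ?I)"
    using card_inj_on_le[OF inj gS fin] .
  also have "\<dots> = (4 * q * b + 1) ^ card (half_totatives q)"
  proof -
    have "int (2 * q * b) - (- int (2 * q * b)) + 1 = int (4 * q * b + 1)" by simp
    then have "card ?I = 4 * q * b + 1" by (simp only: card_atLeastAtMost_int nat_int)
    then show ?thesis by (simp add: card_PiE)
  qed
  finally show "card S \<le> (4 * q * b + 1) ^ card (half_totatives q)" .
qed


section \<open>Cotangents and inverse squared sines at rational angles\<close>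

text \<open>A polynomial whose value at a root of unity is a multiple of a cotangent. The sum is, up to
  the factor \<open>q\<close>, the inverse of \<open>z - 1\<close> at every \<open>q\<close>-th root of unity \<open>z \<noteq> 1\<close>, and \<open>(z + 1) / (z
  - 1) = - \<i> * cot (arg z / 2)\<close>.\<close>

definition cot_poly :: "nat \<Rightarrow> int poly" where
  "cot_poly q = [:1, 1:] * (\<Sum>j<q. monom (int j) j)"

lemma ev_cot_poly_sum: "ev (cot_poly q) z = (1 + z) * (\<Sum>j<q. of_nat j * z ^ j)"
  unfolding cot_poly_def ev_mult by (simp add: ev_pCons ev_sum ev_monom)

lemma sum_index_power:
  fixes z :: complex
  assumes "z ^ q = 1" "z \<noteq> 1"
  shows "(\<Sum>j<q. of_nat j * z ^ j) = of_nat q / (z - 1)"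
proof -
  have "(z - 1) * (\<Sum>j<m. of_nat j * z ^ j) = of_nat m * z ^ m - (\<Sum>j<m. z ^ Suc j)" for m
    by (induction m) (simp_all add: algebra_simps)
  moreover have "(\<Sum>j<q. z ^ Suc j) = z * (\<Sum>j<q. z ^ j)"
    by (simp add: sum_distrib_left)
  moreover have "(\<Sum>j<q. z ^ j) = 0" using assms by (simp add: geometric_sum)
  ultimately have "(z - 1) * (\<Sum>j<q. of_nat j * z ^ j) = of_nat q" using assms by simp
  then show ?thesis using assms(2) by (simp add: field_simps)
qed

lemma ev_cot_poly:
  assumes "q > 0" "\<not> q dvd k"
  shows "ev (cot_poly q) (unity_root q k) = - \<i> * of_real (real q * cot (pi * real k / real q))"
proof -
  let ?z = "unity_root q k" and ?t = "pi * real k / real q"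
  have z1: "?z \<noteq> 1" using assms by (simp add: unity_root_eq_1_iff)
  have "ev (cot_poly q) ?z = (1 + ?z) * (of_nat q / (?z - 1))"
    using sum_index_power[OF unity_root_power_q[OF assms(1)] z1]
    by (simp add: ev_cot_poly_sum)
  moreover have "(1 + ?z) / (?z - 1) = - \<i> * of_real (cot ?t)"
  proof -
    have z: "?z = cis ?t * cis ?t" by (simp add: unity_root_def cis_mult mult.assoc)
    have s: "sin ?t \<noteq> 0"
    proof
      assume "sin ?t = 0"
      then have "?z = 1"
        using sin_cos_squared_add[of ?t]
        by (simp add: z complex_eq_iff power2_eq_square)
      then show False using z1 by simp
    qed
    have 1: "1 + ?z = cis ?t * (2 * of_real (cos ?t))"
      and 2: "?z - 1 = cis ?t * (2 * \<i> * of_real (sin ?t))"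
      using sin_cos_squared_add[of ?t]
      by (simp_all add: z complex_eq_iff power2_eq_square algebra_simps)
    show ?thesis
      unfolding 1 2 using s by (simp add: cot_def field_simps)
  qed
  moreover have "(1 + ?z) * (of_nat q / (?z - 1)) = of_nat q * ((1 + ?z) / (?z - 1))"
    by simp
  ultimately show ?thesis by simp
qed

text \<open>The value of this polynomial is \<open>q\<^sup>2\<close> times the product of two cotangents, and passing to a
  conjugate root of unity multiplies both angles by the same integer.\<close>

definition cot_cot_poly :: "nat \<Rightarrow> nat \<Rightarrow> nat \<Rightarrow> int poly" where
  "cot_cot_poly q a b = - (pcompose (cot_poly q) (monom 1 a) * pcompose (cot_poly q) (monom 1 b))"

lemma ev_cot_cot_poly:
  assumes "q > 0" "\<not> q dvd k * a" "\<not> q dvd k * b"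
  shows "ev (cot_cot_poly q a b) (unity_root q k)
    = of_real ((real q)\<^sup>2 * (cot (pi * real (k * a) / real q) * cot (pi * real (k * b) / real q)))"
proof -
  have "- ((- \<i> * x) * (- \<i> * y)) = x * y" for x y :: complex
    by (simp add: algebra_simps)
  then show ?thesis
    unfolding cot_cot_poly_def ev_minus ev_mult ev_pcompose_monom unity_root_power
      ev_cot_poly[OF assms(1,2)] ev_cot_poly[OF assms(1,3)]
    by (simp add: power2_eq_square)
qed

lemma norm_ev_cot_poly: "cmod (ev (cot_poly q) (unity_root q k)) \<le> 2 * (real q)\<^sup>2"
proof -
  let ?z = "unity_root q k"
  have "cmod (1 + ?z) \<le> 2" using norm_triangle_ineq[of 1 ?z] by simp
  moreover have "cmod (\<Sum>j<q. of_nat j * ?z ^ j) \<le> (\<Sum>j<q. real q)"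
    by (rule sum_norm_le) (simp add: norm_mult norm_power)
  then have "cmod (\<Sum>j<q. of_nat j * ?z ^ j) \<le> (real q)\<^sup>2"
    by (simp add: power2_eq_square)
  ultimately have "cmod (1 + ?z) * cmod (\<Sum>j<q. of_nat j * ?z ^ j) \<le> 2 * (real q)\<^sup>2"
    by (intro mult_mono) auto
  then show ?thesis
    by (simp add: ev_cot_poly_sum norm_mult)
qed

lemma conjugates_bounded_cot_cot:
  assumes "0 < a" "a < q" "0 < b" "b < q"
  shows "conjugates_bounded q (4 * real q ^ 4) (cot_cot_poly q a b)"
  unfolding conjugates_bounded_def
proof
  fix k assume k: "k \<in> totatives q"
  then have "coprime q k" by (simp add: in_totatives_iff coprime_commute)
  then have "\<not> q dvd k * a" "\<not> q dvd k * b"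
    using assms by (auto simp: coprime_dvd_mult_right_iff dest: dvd_imp_le)
  then have "ev (cot_cot_poly q a b) (unity_root q k) \<in> \<real>"
    using ev_cot_cot_poly[of q k a b] assms by simp
  moreover have "cmod (ev (cot_cot_poly q a b) (unity_root q k)) \<le> (2 * (real q)\<^sup>2) * (2 * (real q)\<^sup>2)"
    unfolding cot_cot_poly_def ev_minus ev_mult ev_pcompose_monom unity_root_power norm_minus_cancel norm_mult
    by (intro mult_mono norm_ev_cot_poly) auto
  then have "cmod (ev (cot_cot_poly q a b) (unity_root q k)) \<le> 4 * real q ^ 4"
    by (simp add: power2_eq_square power4_eq_xxxx)
  ultimately show "ev (cot_cot_poly q a b) (unity_root q k) \<in> \<real> \<and>
      cmod (ev (cot_cot_poly q a b) (unity_root q k)) \<le> 4 * real q ^ 4" by simp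
qed

text \<open>The cotangent difference equals \<open>sin (2 * h) / (sin (y - h) * sin (y + h))\<close>, and \<open>sin (y -
  h) * sin (y + h) = (sin y)\<^sup>2 - (sin h)\<^sup>2\<close>. This makes sums of inverse squared sines telescope.\<close>

lemma inverse_sin_squared_le_cot_diff:
  fixes h y :: real
  assumes "0 < h" "h < y" "y + h < pi"
  shows "1 / (sin y)\<^sup>2 \<le> (cot (y - h) - cot (y + h)) / sin (2 * h)"
proof -
  have s: "sin (y - h) > 0" "sin (y + h) > 0" "sin y > 0" "sin (2 * h) > 0"
    using assms by (auto intro!: sin_gt_zero)
  have "cot (y - h) - cot (y + h) = sin (2 * h) / (sin (y - h) * sin (y + h))"
  proof -
    have "sin (2 * h) = sin ((y + h) - (y - h))" by simp
    also have "\<dots> = sin (y + h) * cos (y - h) - cos (y + h) * sin (y - h)" by (rule sin_diff)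
    finally show ?thesis using s by (simp add: cot_def field_simps)
  qed
  then have "(cot (y - h) - cot (y + h)) / sin (2 * h) = 1 / (sin (y - h) * sin (y + h))"
    using s by simp
  moreover have "sin (y - h) * sin (y + h) \<le> (sin y)\<^sup>2"
  proof -
    have "sin (y - h) * sin (y + h) = (sin y * cos h)\<^sup>2 - (cos y * sin h)\<^sup>2"
      by (simp add: sin_add sin_diff power2_eq_square algebra_simps)
    also have "\<dots> = (sin y)\<^sup>2 - (sin h)\<^sup>2"
      by (simp add: power_mult_distrib cos_squared_eq algebra_simps)
    finally show ?thesis by simp
  qed
  ultimately show ?thesis using s by (simp add: frac_le)
qed

text \<open>With \<open>x = pi / q\<close> and step width \<open>h = x / 2\<close> the sum telescopes to at most \<open>cot (3 / 2 * x)
  / sin x\<close>, since \<open>(n + 1 / 2) * x = pi / 2\<close> is a zero of the cotangent. This is less than \<open>1 /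
  (sin x)\<^sup>2\<close> because \<open>sin x < sin (3 / 2 * x)\<close>.\<close>

lemma sum_inverse_sin_squared_less:
  fixes n :: nat
  assumes "n \<ge> 1" and q: "q = 2 * n + 1"
  shows "(\<Sum>a=2..n. 1 / (sin (pi * real a / real q))\<^sup>2) < 1 / (sin (pi / real q))\<^sup>2"
proof -
  define x where "x = pi / real q"
  have x: "0 < x" "x \<le> pi / 3" "(real n + 1 / 2) * x = pi / 2"
    using assms by (auto simp: x_def field_simps)
  have sx: "sin x > 0" using x pi_gt_zero by (intro sin_gt_zero) linarith+
  define c where "c a = cot ((real a - 1 / 2) * x)" for a :: nat
  have "(\<Sum>a=2..n. 1 / (sin (pi * real a / real q))\<^sup>2) \<le> (\<Sum>a=2..n. (c a - c (Suc a)) / sin x)"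
  proof (rule sum_mono)
    fix a assume a: "a \<in> {2..n}"
    have y: "pi * real a / real q = real a * x" by (simp add: x_def)
    have "x * 2 \<le> real a * x" using a x by simp
    moreover have "real a * x \<le> real n * x" using a x by simp
    moreover have "real n * x + x / 2 = pi / 2" using x(3) by (simp add: algebra_simps)
    ultimately have "1 / (sin (real a * x))\<^sup>2
        \<le> (cot (real a * x - x / 2) - cot (real a * x + x / 2)) / sin (2 * (x / 2))"
      using x pi_gt_zero by (intro inverse_sin_squared_le_cot_diff) linarith+
    moreover have "real a * x - x / 2 = (real a - 1 / 2) * x"
      "real a * x + x / 2 = (real (Suc a) - 1 / 2) * x" by (simp_all add: algebra_simps)
    ultimately show "1 / (sin (pi * real a / real q))\<^sup>2 \<le> (c a - c (Suc a)) / sin x"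
      unfolding y c_def by simp
  qed
  also have "\<dots> = (c 2 - c (Suc n)) / sin x"
  proof -
    have "(\<Sum>a=2..n. c a - c (Suc a)) = c 2 - c (Suc n)"
      using assms(1) by (induction n rule: dec_induct) (auto simp: numeral_2_eq_2)
    then show ?thesis by (simp add: sum_divide_distrib[symmetric])
  qed
  also have "c (Suc n) = 0"
  proof -
    have "(real (Suc n) - 1 / 2) * x = pi / 2" using x(3) by (simp add: algebra_simps)
    then show ?thesis unfolding c_def by (simp only:) (simp add: cot_def)
  qed
  also have "(c 2 - 0) / sin x < 1 / (sin x)\<^sup>2"
  proof -
    have 2: "c 2 = cot (3 / 2 * x)" by (simp add: c_def)
    have s: "sin x < sin (3 / 2 * x)"
      using x pi_gt_zero by (intro sin_monotone_2pi) linarith+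
    have "cos (3 / 2 * x) * sin x \<le> 1 * sin x"
      using sx by (intro mult_right_mono) auto
    then have "cos (3 / 2 * x) * sin x < sin (3 / 2 * x)" using s by simp
    then have "c 2 * sin x < 1" using s sx by (simp add: 2 cot_def field_simps)
    then show ?thesis using sx by (simp add: power2_eq_square field_simps)
  qed
  finally show ?thesis by (simp add: x_def)
qed


lemma sin_squared_mod:
  assumes "q > 0" "m mod q = r"
  shows "(sin (pi * real m / real q))\<^sup>2 = (sin (pi * real r / real q))\<^sup>2"
proof -
  have "m = q * (m div q) + r" using assms(2) by auto
  then have "real m = real q * real (m div q) + real r"
    by (metis of_nat_add of_nat_mult)
  then have "pi * real m / real q = real (m div q) * pi + pi * real r / real q"
    using assms(1) by (simp add: field_simps)
  then show ?thesis by (simp add: sin_add power_mult_distrib flip: power_mult)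
qed

lemma sin_squared_complement:
  assumes "r \<le> q" "q > 0"
  shows "(sin (pi * real (q - r) / real q))\<^sup>2 = (sin (pi * real r / real q))\<^sup>2"
proof -
  have "pi * real (q - r) / real q = pi - pi * real r / real q"
    using assms by (simp add: of_nat_diff field_simps)
  then show ?thesis by simp
qed

lemma inverse_sin_squared:
  assumes "q > 0" "\<not> q dvd k"
  shows "1 / (sin (pi * real k / real q))\<^sup>2 = 1 + (cot (pi * real k / real q))\<^sup>2"
proof -
  have "sin (pi * real k / real q) \<noteq> 0"
  proof
    assume "sin (pi * real k / real q) = 0"
    then obtain i :: int where "pi * real k / real q = of_int i * pi"
      by (auto simp: sin_zero_iff_int2)
    then have "real k = of_int i * real q" using assms(1) by (simp add: field_simps)
    then have "int k = i * int q" by (metis of_int_eq_iff of_int_mult of_int_of_nat_eq)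
    then show False using assms(2) by (metis dvd_triv_right int_dvd_int_iff)
  qed
  then show ?thesis
    using sin_cos_squared_add[of "pi * real k / real q"]
    by (simp add: cot_def power_divide field_simps)
qed

text \<open>Suppose some coefficient is not zero, and let \<open>c a0\<close> be one of largest absolute value.
  Multiplying all arguments by the inverse of \<open>a0\<close> modulo \<open>q\<close> is a conjugation, so it yields a
  relation again; in it \<open>c a0\<close> belongs to \<open>1 / (sin (pi / q))\<^sup>2\<close>, while the other terms are
  distinct members of the remaining list, whose sum is smaller.\<close>

theorem inverse_sin_squared_independent:
  fixes n :: nat and c :: "nat \<Rightarrow> int"
  assumes n: "n \<ge> 1" and q: "q = 2 * n + 1"
    and 0: "(\<Sum>a\<in>half_totatives q. of_int (c a) / (sin (pi * real a / real q))\<^sup>2) = 0"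
    and a: "a \<in> half_totatives q"
  shows "c a = 0"
proof -
  let ?H = "half_totatives q"
  define \<beta> where "\<beta> m = 1 / (sin (pi * real m / real q))\<^sup>2" for m
  have q0: "q > 2" using n q by simp
  have H: "0 < a \<and> a \<le> n \<and> coprime a q" if "a \<in> ?H" for a
    using that q by (auto simp: half_totatives_def in_totatives_iff)
  define P where "P = (\<Sum>a\<in>?H. smult (c a) ([:(int q)\<^sup>2:] + cot_cot_poly q a a))"
  have evP: "ev P (unity_root q k) = of_real ((real q)\<^sup>2 * (\<Sum>a\<in>?H. of_int (c a) * \<beta> (k * a)))"
    if k: "coprime k q" for k
  proof -
    have "ev ([:(int q)\<^sup>2:] + cot_cot_poly q a a) (unity_root q k) = of_real ((real q)\<^sup>2 * \<beta> (k * a))"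
      if a: "a \<in> ?H" for a
    proof -
      have "\<not> q dvd a" using H[OF a] q by (auto dest: dvd_imp_le)
      then have "\<not> q dvd k * a"
        using k by (simp add: coprime_dvd_mult_right_iff coprime_commute)
      then have \<beta>: "\<beta> (k * a) = 1 + (cot (pi * real (k * a) / real q))\<^sup>2"
        and ev: "ev (cot_cot_poly q a a) (unity_root q k)
          = of_real ((real q)\<^sup>2 * (cot (pi * real (k * a) / real q))\<^sup>2)"
        using inverse_sin_squared[of q "k * a"] ev_cot_cot_poly[of q k a a] q0
        by (simp_all add: \<beta>_def power2_eq_square)
      show ?thesis
        unfolding ev_add ev \<beta> by (simp add: ev_pCons distrib_left)
    qed
    then show ?thesis
      by (simp add: P_def ev_sum ev_smult sum_distrib_left mult_ac)
  qed
  have conj0: "(\<Sum>a\<in>?H. of_int (c a) * \<beta> (k * a)) = 0" if k: "coprime k q" for k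
  proof -
    have "ev P (unity_root q 1) = 0"
      using evP[of 1] 0 by (simp add: \<beta>_def)
    then have "ev P (unity_root q 1 ^ k) = 0"
      using q0 k unity_root_power_q by (intro ev_conjugate_eq_0[of _ q]) auto
    then have "(real q)\<^sup>2 * (\<Sum>a\<in>?H. of_int (c a) * \<beta> (k * a)) = 0"
      using evP[OF k] by (simp only: unity_root_power mult_1) (simp only: of_real_eq_0_iff)
    then show ?thesis using q0 by simp
  qed
  obtain a0 where a0: "a0 \<in> ?H" and max: "\<And>a. a \<in> ?H \<Longrightarrow> \<bar>c a\<bar> \<le> \<bar>c a0\<bar>"
  proof -
    have "Max ((\<lambda>a. \<bar>c a\<bar>) ` ?H) \<in> (\<lambda>a. \<bar>c a\<bar>) ` ?H"
      using a by (intro Max_in) auto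
    then obtain a0 where a0: "a0 \<in> ?H" "Max ((\<lambda>a. \<bar>c a\<bar>) ` ?H) = \<bar>c a0\<bar>" by auto
    have "\<bar>c a\<bar> \<le> \<bar>c a0\<bar>" if "a \<in> ?H" for a
      unfolding a0(2)[symmetric] using that by (intro Max_ge) auto
    then show ?thesis using that a0(1) by blast
  qed
  obtain k where k: "[a0 * k = 1] (mod q)"
    using cong_solve_coprime_nat[of a0 q] H[OF a0] by auto
  have kq: "coprime k q"
    using cong_imp_coprime[OF cong_sym[OF k]] by simp
  \<comment> \<open>The representative in \<open>{0..n}\<close> of \<open>m\<close> up to sign modulo \<open>q\<close>, on which \<open>\<beta>\<close> depends.\<close>
  define fold where "fold m = (if m mod q \<le> n then m mod q else q - m mod q)" for m
  have \<beta>_fold: "\<beta> m = \<beta> (fold m)" for m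
  proof -
    have "(sin (pi * real m / real q))\<^sup>2 = (sin (pi * real (m mod q) / real q))\<^sup>2"
      by (rule sin_squared_mod) (use q0 in auto)
    moreover have "(sin (pi * real (q - m mod q) / real q))\<^sup>2 = (sin (pi * real (m mod q) / real q))\<^sup>2"
      by (rule sin_squared_complement) (use q0 in auto)
    ultimately show ?thesis by (simp add: \<beta>_def fold_def)
  qed
  have fold_eq: "u + v = q"
    if "u \<noteq> v" "u < q" "v < q" "(if u \<le> n then u else q - u) = (if v \<le> n then v else q - v)"
    for u v
    using that by (auto split: if_splits)
  have fold_eqD: "a = b" if "a \<in> ?H" "b \<in> ?H" "fold (k * a) = fold (k * b)" for a b
  proof -
    have q1: "k * a mod q < q" "k * b mod q < q" using q0 by simp_all
    have "[k * a = k * b] (mod q) \<or> [k * a + k * b = 0] (mod q)"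
    proof (cases "k * a mod q = k * b mod q")
      case False
      then have "k * a mod q + k * b mod q = q"
        using fold_eq[of "k * a mod q" "k * b mod q"] that(3) q1 by (simp add: fold_def)
      moreover have "(k * a + k * b) mod q = (k * a mod q + k * b mod q) mod q"
        by (simp only: mod_add_eq)
      ultimately show ?thesis by (simp add: cong_def)
    qed (simp add: cong_def)
    then have "[a = b] (mod q) \<or> [a + b = 0] (mod q)"
    proof
      assume "[k * a = k * b] (mod q)"
      then show ?thesis using kq by (simp add: cong_mult_lcancel_nat coprime_commute)
    next
      assume "[k * a + k * b = 0] (mod q)"
      then have "q dvd k * (a + b)" by (simp add: cong_0_iff distrib_left)
      then show ?thesis using kq by (simp add: coprime_dvd_mult_right_iff coprime_commute cong_0_iff)
    qed
    then show ?thesis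
    proof
      assume "[a = b] (mod q)"
      then show ?thesis using H[OF that(1)] H[OF that(2)] q by (simp add: cong_def)
    next
      assume "[a + b = 0] (mod q)"
      then have "q dvd a + b" by (simp add: cong_0_iff)
      then show ?thesis using H[OF that(1)] H[OF that(2)] q by (auto dest: dvd_imp_le)
    qed
  qed
  have fold_a0: "fold (k * a0) = 1"
    using k n q by (simp add: fold_def cong_def mult.commute)
  have fold_range: "fold (k * a) \<in> {2..n}" if a: "a \<in> ?H - {a0}" for a
  proof -
    have "fold (k * a) \<noteq> 1" using fold_eqD[of a a0] a a0 fold_a0 by auto
    moreover have "\<not> q dvd a" using H[of a] a q by (auto dest: dvd_imp_le)
    then have "\<not> q dvd k * a"
      using kq by (simp add: coprime_dvd_mult_right_iff coprime_commute)
    then have "k * a mod q > 0" by (simp add: dvd_eq_mod_eq_0)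
    moreover have "k * a mod q < q" using q0 by simp
    moreover have "(if u \<le> n then u else q - u) \<in> {2..n}"
      if "0 < u" "u < q" "(if u \<le> n then u else q - u) \<noteq> 1" for u
      using that q by (auto split: if_splits)
    ultimately show ?thesis unfolding fold_def by blast
  qed
  have \<beta>0: "\<beta> m \<ge> 0" for m by (simp add: \<beta>_def)
  have "(\<Sum>a\<in>?H - {a0}. \<beta> (k * a)) = (\<Sum>a\<in>?H - {a0}. \<beta> (fold (k * a)))"
    using \<beta>_fold by (intro sum.cong) auto
  also have "\<dots> = (\<Sum>b\<in>(\<lambda>a. fold (k * a)) ` (?H - {a0}). \<beta> b)"
    by (subst sum.reindex) (use fold_eqD in \<open>auto simp: inj_on_def\<close>)
  also have "\<dots> \<le> (\<Sum>b=2..n. \<beta> b)"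
  proof (rule sum_mono2)
    show "(\<lambda>a. fold (k * a)) ` (?H - {a0}) \<subseteq> {2..n}"
      by (rule image_subsetI) (rule fold_range)
  qed (use \<beta>0 in auto)
  also have "\<dots> < \<beta> 1"
    using sum_inverse_sin_squared_less[OF n q] by (simp add: \<beta>_def)
  finally have less: "(\<Sum>a\<in>?H - {a0}. \<beta> (k * a)) < \<beta> 1" .
  have "(\<Sum>a\<in>?H. of_int (c a) * \<beta> (k * a))
      = of_int (c a0) * \<beta> (k * a0) + (\<Sum>a\<in>?H - {a0}. of_int (c a) * \<beta> (k * a))"
    by (rule sum.remove) (use a0 in auto)
  then have "of_int (c a0) * \<beta> 1 = - (\<Sum>a\<in>?H - {a0}. of_int (c a) * \<beta> (k * a))"
    using conj0[OF kq] \<beta>_fold[of "k * a0"] by (simp add: fold_a0)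
  then have "\<bar>of_int (c a0) * \<beta> 1\<bar> = \<bar>\<Sum>a\<in>?H - {a0}. of_int (c a) * \<beta> (k * a)\<bar>"
    by (simp only: abs_minus_cancel)
  then have "\<bar>of_int (c a0)\<bar> * \<beta> 1 = \<bar>\<Sum>a\<in>?H - {a0}. of_int (c a) * \<beta> (k * a)\<bar>"
    by (simp only: abs_mult abs_of_nonneg[OF \<beta>0])
  also have "\<dots> \<le> (\<Sum>a\<in>?H - {a0}. \<bar>of_int (c a0)\<bar> * \<beta> (k * a))"
  proof (rule order_trans[OF sum_abs], rule sum_mono)
    fix a assume "a \<in> ?H - {a0}"
    then have "\<bar>c a\<bar> \<le> \<bar>c a0\<bar>" using max by simp
    then have "\<bar>of_int (c a)\<bar> \<le> \<bar>of_int (c a0) :: real\<bar>" by linarith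
    then show "\<bar>of_int (c a) * \<beta> (k * a)\<bar> \<le> \<bar>of_int (c a0)\<bar> * \<beta> (k * a)"
      using \<beta>0 by (simp add: abs_mult mult_right_mono)
  qed
  also have "\<dots> = \<bar>of_int (c a0)\<bar> * (\<Sum>a\<in>?H - {a0}. \<beta> (k * a))"
    by (simp add: sum_distrib_left)
  finally have "\<bar>of_int (c a0) :: real\<bar> * \<beta> 1 \<le> \<bar>of_int (c a0)\<bar> * (\<Sum>a\<in>?H - {a0}. \<beta> (k * a))" .
  moreover have "\<bar>of_int (c a0) :: real\<bar> * (\<Sum>a\<in>?H - {a0}. \<beta> (k * a)) < \<bar>of_int (c a0)\<bar> * \<beta> 1"
    if "c a0 \<noteq> 0"
    using less that by (intro mult_strict_left_mono) auto
  ultimately have "c a0 = 0" by linarith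
  then show ?thesis using max[OF a] by simp
qed


section \<open>Polynomial growth\<close>

text \<open>If \<open>gr\<close> were bounded by a power with exponent \<open>s < r\<close>, then along the numbers \<open>L + r * N\<close>
  the value \<open>(N + 1) ^ r\<close> would be at most a constant multiple of \<open>(N + 1) ^ s\<close>.\<close>

lemma growth_rate_eqI:
  fixes gr :: "nat \<Rightarrow> nat" and r :: nat
  assumes upper: "\<And>m. gr m \<le> C * (D * m + 1) ^ r"
    and lower: "\<And>N. (N + 1) ^ r \<le> gr (L + r * N)"
  shows "polynomial_growth gr" "polynomial_growth_rate gr = r"
proof -
  have big: "(\<lambda>m. real (gr m)) \<in> O(\<lambda>m. real m ^ r)"
  proof (rule bigoI[of _ "real C * (real D + 1) ^ r"])
    show "\<forall>\<^sub>F m in sequentially. norm (real (gr m)) \<le> real C * (real D + 1) ^ r * norm (real m ^ r)"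
      using eventually_ge_at_top[of 1]
    proof eventually_elim
      case (elim m)
      have "real (gr m) \<le> real (C * (D * m + 1) ^ r)" using upper[of m] by (simp only: of_nat_le_iff)
      also have "\<dots> = real C * (real D * real m + 1) ^ r" by (simp add: add.commute)
      also have "\<dots> \<le> real C * ((real D + 1) * real m) ^ r"
        using elim by (intro mult_left_mono power_mono) (auto simp: algebra_simps)
      also have "\<dots> = real C * (real D + 1) ^ r * real m ^ r" by (simp add: power_mult_distrib)
      finally show ?case by simp
    qed
  qed
  have "(\<lambda>m. real (gr m)) \<in> O(\<lambda>m. real m powr real r)"
  proof -
    have "\<forall>\<^sub>F m in sequentially. norm (real m ^ r) \<le> 1 * norm (real m powr real r)"
      using eventually_ge_at_top[of 1] by eventually_elim (simp add: powr_realpow)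
    then show ?thesis by (intro landau_o.big_trans[OF big] bigoI)
  qed
  then show "polynomial_growth gr"
    unfolding polynomial_growth_def by (intro exI[of _ "real r"]) simp
  show "polynomial_growth_rate gr = r"
    unfolding polynomial_growth_rate_def
  proof (rule Least_equality)
    show "(\<lambda>m. real (gr m)) \<in> O(\<lambda>m. real m ^ r)" by (rule big)
  next
    fix s assume "(\<lambda>m. real (gr m)) \<in> O(\<lambda>m. real m ^ s)"
    show "r \<le> s"
    proof (rule ccontr)
      assume "\<not> r \<le> s"
      note s = \<open>(\<lambda>m. real (gr m)) \<in> O(\<lambda>m. real m ^ s)\<close> this
      obtain c where c: "c > 0" "\<forall>\<^sub>F m in sequentially. norm (real (gr m)) \<le> c * norm (real m ^ s)"
        using s(1) by (elim landau_o.bigE)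
      then obtain m0 where m0: "\<And>m. m \<ge> m0 \<Longrightarrow> real (gr m) \<le> c * real m ^ s"
        by (auto simp: eventually_sequentially)
      define B where "B = c * (real L + real r) ^ s"
      obtain N where N: "N \<ge> m0" "real N > B"
      proof -
        obtain N where "real N > B" using reals_Archimedean2 by blast
        then show ?thesis using that[of "max N m0"] by simp
      qed
      have "m0 \<le> L + r * N" using N(1) s(2) by (cases r) auto
      have "real (N + 1) ^ r \<le> real (gr (L + r * N))"
        using lower[of N] by (metis of_nat_le_iff of_nat_power)
      also have "\<dots> \<le> c * real (L + r * N) ^ s" using m0[OF \<open>m0 \<le> L + r * N\<close>] .
      also have "\<dots> \<le> c * ((real L + real r) * real (N + 1)) ^ s"
        using c(1) by (intro mult_left_mono power_mono) (auto simp: algebra_simps)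
      also have "\<dots> = B * real (N + 1) ^ s" by (simp add: B_def power_mult_distrib)
      also have "\<dots> < real (N + 1) * real (N + 1) ^ s"
        using N(2) by (intro mult_strict_right_mono) auto
      also have "\<dots> = real (N + 1) ^ Suc s" by simp
      also have "\<dots> \<le> real (N + 1) ^ r" using s(2) by (intro power_increasing) auto
      finally show False by simp
    qed
  qed
qed

section \<open>The seeds reachable from the initial one\<close>

text \<open>The angles of the seeds are multiples of \<open>pi / q\<close>. Since \<open>q\<close> is odd, \<open>A + C\<close> never has the
  value \<open>pi / 2\<close> that separates acyclic from cyclic seeds.\<close>

locale odd_belt = belt +
  fixes n q :: nat
  assumes n: "n \<ge> 1" and q: "q = 2 * n + 1"
begin

definition ang :: "nat \<Rightarrow> real" where
  "ang a = pi * real a / real q"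

definition node :: "real \<Rightarrow> nat \<Rightarrow> nat \<Rightarrow> real \<Rightarrow> seed" where
  "node \<sigma> a c x = seed_of (belt_seed \<sigma> (ang a) (ang c) x)"

abbreviation "M \<equiv> seed_mutation pos"

lemma q_gr_2: "q > 2"
  using n q by simp

lemma ang_pos: "0 < a \<Longrightarrow> 0 < ang a"
  using q_gr_2 by (simp add: ang_def)

lemma ang_nonneg: "0 \<le> ang a"
  by (simp add: ang_def)

lemma ang_less_half_pi_iff: "ang a < pi / 2 \<longleftrightarrow> a \<le> n"
proof -
  have "ang a < pi / 2 \<longleftrightarrow> 2 * real a < real q"
    using q_gr_2 by (simp add: ang_def field_simps)
  also have "\<dots> \<longleftrightarrow> 2 * a < q" by linarith
  finally show ?thesis using q by auto
qed

lemma ang_neq_half_pi: "ang a \<noteq> pi / 2"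
proof
  assume "ang a = pi / 2"
  then have "2 * real a = real q" using q_gr_2 by (simp add: ang_def field_simps)
  then have "2 * a = q" by linarith
  then show False using q by presburger
qed

lemma ang_add: "ang (a + c) = ang a + ang c"
  by (simp add: ang_def distrib_left add_divide_distrib)

lemma ang_diff: "c \<le> a \<Longrightarrow> ang (a - c) = ang a - ang c"
  using ang_add[of c "a - c"] by simp

lemma ang_q: "ang q = pi"
  using q_gr_2 by (simp add: ang_def)

lemma ang_le_iff: "ang a \<le> ang c \<longleftrightarrow> a \<le> c"
  using q_gr_2 by (simp add: ang_def field_simps)

lemma ang_third: "a + c \<le> q \<Longrightarrow> ang (q - a - c) = pi - ang a - ang c"
  by (simp add: ang_diff ang_q ang_add)

text \<open>A bound for \<open>q\<^sup>2\<close> times any conjugate of \<open>\<plusminus> 1 \<plusminus> cot (i * \<alpha>) * cot (j * \<alpha>)\<close>.\<close>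

definition const :: nat where
  "const = q\<^sup>2 + 4 * q ^ 4"

text \<open>A condition on the displacements that result from \<open>l\<close> mutations. It keeps track of all
  conjugates of a displacement, not only of its size, since the count is done in the space of the
  conjugates.\<close>

definition displacement :: "nat \<Rightarrow> real \<Rightarrow> bool" where
  "displacement l t \<longleftrightarrow> (\<exists>P. conjugates_bounded q (real (const * l)) P \<and>
     ev P (unity_root q 1) = of_real ((real q)\<^sup>2 * t))"

lemma displacement_0: "displacement l 0"
  unfolding displacement_def by (rule exI[of _ 0]) (simp add: conjugates_bounded_def)

lemma displacement_add:
  assumes "displacement l t" "displacement l' t'"
  shows "displacement (l + l') (t + t')"
proof -
  obtain P P' where P: "conjugates_bounded q (real (const * l)) P"
      "ev P (unity_root q 1) = of_real ((real q)\<^sup>2 * t)"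
    and P': "conjugates_bounded q (real (const * l')) P'"
      "ev P' (unity_root q 1) = of_real ((real q)\<^sup>2 * t')"
    using assms unfolding displacement_def by blast
  have "conjugates_bounded q (real (const * (l + l'))) (P + P')"
    unfolding conjugates_bounded_def
  proof
    fix k assume "k \<in> totatives q"
    then show "ev (P + P') (unity_root q k) \<in> \<real> \<and> cmod (ev (P + P') (unity_root q k)) \<le> real (const * (l + l'))"
      using P(1) P'(1) unfolding conjugates_bounded_def ev_add
      by (simp add: distrib_left norm_triangle_mono)
  qed
  then show ?thesis
    unfolding displacement_def using P(2) P'(2)
    by (intro exI[of _ "P + P'"]) (simp add: ev_add distrib_left)
qed

lemma displacement_cot:
  assumes "0 < a" "a \<le> n" "0 < b" "b \<le> n" "\<bar>i\<bar> \<le> 1" "\<bar>j\<bar> \<le> 1"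
  shows "displacement 1 (of_int i + of_int j * (cot (ang a) * cot (ang b)))"
proof -
  let ?P = "[:i * (int q)\<^sup>2:] + smult j (cot_cot_poly q a b)"
  have ab: "a < q" "b < q" using assms q by auto
  have "conjugates_bounded q (real (const * 1)) ?P"
    unfolding conjugates_bounded_def
  proof
    fix k assume k: "k \<in> totatives q"
    let ?e = "ev (cot_cot_poly q a b) (unity_root q k)"
    have e: "?e \<in> \<real>" "cmod ?e \<le> 4 * real q ^ 4"
      using conjugates_bounded_cot_cot[of a q b] ab assms k by (auto simp: conjugates_bounded_def)
    have ev: "ev ?P (unity_root q k) = of_int (i * (int q)\<^sup>2) + of_int j * ?e"
      by (simp add: ev_add ev_pCons ev_smult)
    have "cmod (of_int (i * (int q)\<^sup>2)) \<le> (real q)\<^sup>2"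
    proof -
      have "\<bar>real_of_int i\<bar> \<le> 1" using assms(5) by linarith
      then have "\<bar>real_of_int i\<bar> * (real q)\<^sup>2 \<le> 1 * (real q)\<^sup>2" by (intro mult_right_mono) auto
      then show ?thesis by (simp add: norm_mult norm_power)
    qed
    moreover have "cmod (of_int j * ?e) \<le> 4 * real q ^ 4"
    proof -
      have "\<bar>real_of_int j\<bar> \<le> 1" using assms(6) by linarith
      then have "\<bar>real_of_int j\<bar> * cmod ?e \<le> 1 * (4 * real q ^ 4)" using e(2) by (intro mult_mono) auto
      then show ?thesis by (simp add: norm_mult)
    qed
    ultimately have "cmod (ev ?P (unity_root q k)) \<le> (real q)\<^sup>2 + 4 * real q ^ 4"
      unfolding ev by (rule norm_triangle_mono)
    then show "ev ?P (unity_root q k) \<in> \<real> \<and> cmod (ev ?P (unity_root q k)) \<le> real (const * 1)"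
      using e(1) unfolding ev by (simp add: const_def)
  qed
  moreover have "ev ?P (unity_root q 1) = of_real ((real q)\<^sup>2 * (of_int i + of_int j * (cot (ang a) * cot (ang b))))"
  proof -
    have "\<not> q dvd a" "\<not> q dvd b" using ab assms by (auto dest: dvd_imp_le)
    then show ?thesis
      using ev_cot_cot_poly[of q 1 a b] q_gr_2
      by (simp add: ev_add ev_pCons ev_smult ang_def algebra_simps)
  qed
  ultimately show ?thesis unfolding displacement_def by blast
qed

lemma node_mutation_cases:
  assumes \<sigma>: "\<sigma> \<in> {1, -1}" and a: "1 \<le> a" "a \<le> n" and c: "c \<le> n"
    and S': "(node \<sigma> a c x, S') \<in> M"
  shows "\<exists>\<sigma>' a' c' t. \<sigma>' \<in> {1, -1} \<and> 1 \<le> a' \<and> a' \<le> n \<and> c' \<le> n \<and> displacement 1 t \<and> S' = node \<sigma>' a' c' (x + t)"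
proof -
  have \<sigma>1: "\<sigma> * \<sigma> = 1" "- \<sigma> \<in> {1, -1}" using \<sigma> by auto
  have sum: "ang a + ang c > pi / 2 \<longleftrightarrow> a + c > n" "ang a + ang c < pi / 2 \<longleftrightarrow> a + c \<le> n"
    using ang_less_half_pi_iff[of "a + c"] ang_neq_half_pi[of "a + c"] unfolding ang_add by linarith+
  have S'': "(seed_of (belt_seed \<sigma> (ang a) (ang c) x), S') \<in> M"
    using S' by (simp only: node_def)
  have result: ?thesis
    if "S' = node \<sigma>' a' c' (x + t)" "\<sigma>' \<in> {1, -1}" "1 \<le> a'" "a' \<le> n" "c' \<le> n" "displacement 1 t"
    for \<sigma>' a' c' t
    using that by blast
  show ?thesis
  proof (rule mutation_seed_cases[OF \<sigma>1(1) _ _ _ _ _ S''])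
    show "0 < ang a" "0 \<le> ang c" using a by (simp_all add: ang_pos ang_nonneg)
    show "ang a < pi / 2" "ang c < pi / 2" using a c unfolding ang_less_half_pi_iff by simp_all
    show "ang a + ang c \<noteq> pi / 2" using ang_neq_half_pi[of "a + c"] by (simp add: ang_add)
  next
    assume "ang a \<le> ang c" "S' = seed_of (belt_seed \<sigma> (ang a) (ang c - ang a) x)"
    then have "S' = node \<sigma> a (c - a) (x + 0)" by (simp add: node_def ang_le_iff ang_diff)
    then show ?thesis by (rule result) (use \<sigma> a c displacement_0 in auto)
  next
    assume *: "ang c < ang a"
      "S' = seed_of (belt_seed \<sigma> (ang a - ang c) (ang c) (x + (1 + cot (ang a) * cot (ang a - ang c))))"
    then have "c < a" using ang_le_iff[of a c] by linarith
    then have "S' = node \<sigma> (a - c) c (x + (of_int 1 + of_int 1 * (cot (ang a) * cot (ang (a - c)))))"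
      using * by (simp add: node_def ang_diff)
    moreover have "1 \<le> a - c" "a - c \<le> n" using a \<open>c < a\<close> by auto
    moreover have "displacement 1 (of_int 1 + of_int 1 * (cot (ang a) * cot (ang (a - c))))"
      using a \<open>c < a\<close> by (intro displacement_cot) auto
    ultimately show ?thesis using \<sigma> c by - (rule result, assumption, auto)
  next
    assume *: "pi / 2 < ang a + ang c"
      "S' = seed_of (belt_seed (- \<sigma>) (pi - ang a - ang c) (ang a)
              (x + (- 1 + cot (ang a) * cot (pi - ang a - ang c))))"
    have ac: "n < a + c" using * sum by simp
    have acq: "a + c \<le> q" using a c q by simp
    have b: "1 \<le> q - a - c" "q - a - c \<le> n" using ac a c q by auto
    have "S' = node (- \<sigma>) (q - a - c) a (x + (of_int (- 1) + of_int 1 * (cot (ang a) * cot (ang (q - a - c)))))"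
      unfolding node_def ang_third[OF acq] using * by simp
    moreover have "displacement 1 (of_int (- 1) + of_int 1 * (cot (ang a) * cot (ang (q - a - c))))"
      using a b by (intro displacement_cot) auto
    ultimately show ?thesis using \<sigma>1 a b by - (rule result, assumption, auto)
  next
    assume *: "pi / 2 < ang a + ang c"
      "S' = seed_of (belt_seed (- \<sigma>) (ang c) (pi - ang a - ang c)
              (x - (- 1 + cot (ang c) * cot (ang a))))"
    have ac: "n < a + c" using * sum by simp
    have acq: "a + c \<le> q" using a c q by simp
    have b: "1 \<le> q - a - c" "q - a - c \<le> n" using ac a c q by auto
    have c1: "1 \<le> c" using ac a by simp
    have "S' = node (- \<sigma>) c (q - a - c) (x + (of_int 1 + of_int (- 1) * (cot (ang c) * cot (ang a))))"
      unfolding node_def ang_third[OF acq] using * by (simp add: algebra_simps)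
    moreover have "displacement 1 (of_int 1 + of_int (- 1) * (cot (ang c) * cot (ang a)))"
      using a c c1 by (intro displacement_cot) auto
    ultimately show ?thesis using \<sigma>1 c c1 b by - (rule result, assumption, auto)
  next
    assume *: "ang a + ang c < pi / 2"
      "S' = seed_of (belt_seed \<sigma> (ang a + ang c) (ang c) (x - (1 + cot (ang a + ang c) * cot (ang a))))"
    have ac: "a + c \<le> n" using * sum by simp
    have "S' = node \<sigma> (a + c) c (x + (of_int (- 1) + of_int (- 1) * (cot (ang (a + c)) * cot (ang a))))"
      using * by (simp add: node_def ang_add algebra_simps)
    moreover have "displacement 1 (of_int (- 1) + of_int (- 1) * (cot (ang (a + c)) * cot (ang a)))"
      using a ac by (intro displacement_cot) auto
    moreover have "1 \<le> a + c" using a by simp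
    ultimately show ?thesis using \<sigma> c ac by - (rule result, assumption, auto)
  next
    assume *: "ang a + ang c < pi / 2" "S' = seed_of (belt_seed \<sigma> (ang a) (ang a + ang c) x)"
    have ac: "a + c \<le> n" using * sum by simp
    have "S' = node \<sigma> a (a + c) (x + 0)" using * by (simp add: node_def ang_add)
    then show ?thesis by (rule result) (use \<sigma> a ac displacement_0 in auto)
  qed
qed



section \<open>The exchange graph as the orbit of sequences of mutations\<close>

text \<open>A single labelled mutation yields both directions of an edge between the unlabelled seeds.\<close>

lemma seed_mutation_both_ways:
  assumes "\<sigma> * \<sigma> = 1" "bij \<tau>"
    and "labelled_mutation pos k (belt_seed \<sigma> A C x) (relabel \<tau> t)"
  shows "(seed_of (belt_seed \<sigma> A C x), seed_of t) \<in> M" "(seed_of t, seed_of (belt_seed \<sigma> A C x)) \<in> M"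
proof -
  show "(seed_of (belt_seed \<sigma> A C x), seed_of t) \<in> M"
    unfolding seed_mutation_seed_of_iff using assms(3) seed_of_relabel[OF assms(2)] by metis
  have "labelled_mutation pos (\<tau> k) t (relabel (inv \<tau>) (belt_seed \<sigma> A C x))"
    by (rule labelled_mutation_reverse[OF assms(2) aff_form_belt_seed[OF assms(1)] assms(3)])
  then show "(seed_of t, seed_of (belt_seed \<sigma> A C x)) \<in> M"
    unfolding seed_mutation_seed_of_iff
    using seed_of_relabel[OF bij_imp_bij_inv[OF assms(2)]] by metis
qed

text \<open>By this symmetry a walk in the exchange graph is a sequence of mutations.\<close>

lemma node_mutation_sym:
  assumes "\<sigma> \<in> {1, -1}" "(node \<sigma> a c x, S) \<in> M"
  shows "(S, node \<sigma> a c x) \<in> M"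
proof -
  have \<sigma>: "\<sigma> * \<sigma> = 1" using assms(1) by auto
  obtain k s where s: "labelled_mutation pos k (belt_seed \<sigma> (ang a) (ang c) x) s" "S = seed_of s"
    using assms(2) unfolding node_def seed_mutation_seed_of_iff by blast
  have "labelled_mutation pos k (belt_seed \<sigma> (ang a) (ang c) x) (relabel id s)"
    using s(1) by (simp only: relabel_id)
  then show ?thesis
    unfolding node_def s(2) by (rule seed_mutation_both_ways(2)[OF \<sigma> bij_id])
qed

abbreviation "origin \<equiv> node 1 1 n 0"

lemma reachable_node:
  assumes "(origin, S) \<in> M ^^ l"
  shows "\<exists>\<sigma> a c t. \<sigma> \<in> {1, -1} \<and> 1 \<le> a \<and> a \<le> n \<and> c \<le> n \<and> displacement l t \<and> S = node \<sigma> a c t"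
  using assms
proof (induction l arbitrary: S)
  case 0
  have "S = node 1 1 n 0" using 0 by simp
  then show ?case using n displacement_0[of 0] by blast
next
  case (Suc l)
  then obtain T where T: "(origin, T) \<in> M ^^ l" "(T, S) \<in> M" by auto
  obtain \<sigma> a c t where 1: "\<sigma> \<in> {1, -1}" "1 \<le> a" "a \<le> n" "c \<le> n" "displacement l t" "T = node \<sigma> a c t"
    using Suc.IH[OF T(1)] by blast
  obtain \<sigma>' a' c' t' where 2: "\<sigma>' \<in> {1, -1}" "1 \<le> a'" "a' \<le> n" "c' \<le> n" "displacement 1 t'"
      "S = node \<sigma>' a' c' (t + t')"
    using node_mutation_cases[OF 1(1-4)] T(2) 1(6) by blast
  have "displacement (Suc l) (t + t')" using displacement_add[OF 1(5) 2(5)] by simp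
  then show ?case using 2 by blast
qed

definition mutation_ball :: "nat \<Rightarrow> seed set" where
  "mutation_ball m = {S. \<exists>l\<le>m. (origin, S) \<in> M ^^ l}"

text \<open>All vertices lie in the family of belt seeds, on which mutation is symmetric. So the walks
  in the exchange graph that start at the initial seed are exactly the sequences of mutations.\<close>

lemma exchange_growth_eq_card_ball:
  "exchange_growth pos (belt_seed 1 (ang 1) (ang n) 0) m = card (mutation_ball m)"
proof -
  define V where "V = exchange_vertices pos origin"
  define E where "E = exchange_edges pos origin"
  have V: "S \<in> V \<longleftrightarrow> (\<exists>l. (origin, S) \<in> M ^^ l)" for S
    by (simp add: V_def exchange_vertices_def rtrancl_power)
  have E_M: "(S, T) \<in> M" if "(S, T) \<in> E" for S T
  proof -
    have T: "T \<in> V" and ST: "(S, T) \<in> M \<or> (T, S) \<in> M"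
      using that by (auto simp: E_def V_def exchange_edges_def)
    obtain l where "(origin, T) \<in> M ^^ l" using T unfolding V ..
    then obtain \<sigma> a c t where "\<sigma> \<in> {1, -1}" "T = node \<sigma> a c t"
      using reachable_node by blast
    then show ?thesis using ST node_mutation_sym[of \<sigma> a c t S] by fast
  qed
  have EM: "(origin, S) \<in> E ^^ l \<longleftrightarrow> (origin, S) \<in> M ^^ l" for S l
  proof
    show "(origin, S) \<in> E ^^ l \<Longrightarrow> (origin, S) \<in> M ^^ l"
    proof (induction l arbitrary: S)
      case (Suc l)
      then obtain T where T: "(origin, T) \<in> E ^^ l" "(T, S) \<in> E" by auto
      show ?case using relpow_Suc_I[OF Suc.IH[OF T(1)] E_M[OF T(2)]] .
    qed simp
    show "(origin, S) \<in> M ^^ l \<Longrightarrow> (origin, S) \<in> E ^^ l"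
    proof (induction l arbitrary: S)
      case (Suc l)
      then obtain T where T: "(origin, T) \<in> M ^^ l" "(T, S) \<in> M" by auto
      then have "T \<in> V" "S \<in> V" using V Suc.prems by blast+
      then have "(T, S) \<in> E" using T(2) by (simp add: E_def V_def exchange_edges_def)
      then show ?case by (rule relpow_Suc_I[OF Suc.IH[OF T(1)]])
    qed simp
  qed
  have dist: "graph_dist E origin S \<le> m \<longleftrightarrow> S \<in> mutation_ball m" if "S \<in> V" for S
  proof
    have "\<exists>l. (origin, S) \<in> E ^^ l" using that V EM by blast
    then have "(origin, S) \<in> E ^^ graph_dist E origin S"
      unfolding graph_dist_def by (rule LeastI_ex)
    then show "graph_dist E origin S \<le> m \<Longrightarrow> S \<in> mutation_ball m"
      unfolding mutation_ball_def EM by blast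
  next
    assume "S \<in> mutation_ball m"
    then obtain l where "l \<le> m" "(origin, S) \<in> E ^^ l"
      unfolding mutation_ball_def EM by blast
    then show "graph_dist E origin S \<le> m"
      unfolding graph_dist_def by (meson Least_le order_trans)
  qed
  have "{S \<in> V. graph_dist E origin S \<le> m} = mutation_ball m"
  proof -
    have "S \<in> V" if "S \<in> mutation_ball m" for S
      using that unfolding mutation_ball_def V by blast
    then show ?thesis using dist by blast
  qed
  then show ?thesis
    by (simp add: exchange_growth_def graph_growth_def V_def E_def node_def Let_def)
qed

lemma displacement_mono: "displacement l t \<Longrightarrow> l \<le> m \<Longrightarrow> displacement m t"
  using displacement_add[of l t "m - l" 0] displacement_0 by simp


section \<open>The upper bound\<close>

abbreviation "half_phi \<equiv> card (half_totatives q)"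

text \<open>Finitely many shapes, combined with the bound on the number of positions.\<close>

lemma mutation_ball_upper:
  "finite (mutation_ball m)"
  "card (mutation_ball m) \<le> 2 * n * (n + 1) * (4 * q * const * m + 1) ^ half_phi"
proof -
  define Y where "Y = {y. \<exists>P. conjugates_bounded q (real (const * m)) P \<and> y = ev P (unity_root q 1)}"
  have Y: "finite Y" "card Y \<le> (4 * q * const * m + 1) ^ half_phi"
    using card_bounded_conjugates[OF q_gr_2, of "const * m"] by (simp_all add: Y_def mult.assoc)
  let ?X = "{1, -1 :: real} \<times> {1..n} \<times> {..n} \<times> Y"
  define f where "f = (\<lambda>(\<sigma>, a, c, y). node \<sigma> a c (Re y / (real q)\<^sup>2))"
  have sub: "mutation_ball m \<subseteq> f ` ?X"
  proof
    fix S assume "S \<in> mutation_ball m"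
    then obtain l where l: "l \<le> m" "(origin, S) \<in> M ^^ l" by (auto simp: mutation_ball_def)
    obtain \<sigma> a c t where 1: "\<sigma> \<in> {1, -1}" "1 \<le> a" "a \<le> n" "c \<le> n" "displacement l t" "S = node \<sigma> a c t"
      using reachable_node[OF l(2)] by blast
    let ?y = "complex_of_real ((real q)\<^sup>2 * t)"
    obtain P where P: "conjugates_bounded q (real (const * m)) P" "ev P (unity_root q 1) = ?y"
      using displacement_mono[OF 1(5) l(1)] unfolding displacement_def by (elim exE conjE)
    have "?y \<in> Y" unfolding Y_def using P(1) P(2)[symmetric] by (intro CollectI exI[of _ P] conjI)
    then have "(\<sigma>, a, c, ?y) \<in> ?X" using 1(1-4) by simp
    moreover have "f (\<sigma>, a, c, ?y) = S"
    proof -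
      have "Re ?y / (real q)\<^sup>2 = t" using q_gr_2 by simp
      then show ?thesis unfolding f_def prod.case 1(6) by (rule arg_cong)
    qed
    ultimately show "S \<in> f ` ?X" by (intro image_eqI[of S f]) (rule sym)
  qed
  have fin: "finite ?X" using Y(1) by simp
  show "finite (mutation_ball m)" using sub fin by (meson finite_imageI finite_subset)
  have "card (mutation_ball m) \<le> card (f ` ?X)" using sub fin by (intro card_mono) auto
  also have "\<dots> \<le> card ?X" using fin by (rule card_image_le)
  also have "\<dots> = 2 * n * (n + 1) * card Y" by (simp add: card_cartesian_product algebra_simps)
  also have "\<dots> \<le> 2 * n * (n + 1) * (4 * q * const * m + 1) ^ half_phi"
    using Y(2) by (intro mult_left_mono) auto
  finally show "card (mutation_ball m) \<le> 2 * n * (n + 1) * (4 * q * const * m + 1) ^ half_phi" .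
qed


section \<open>Walks between shapes and the lower bound\<close>

text \<open>A shape \<open>(\<sigma>, a, c)\<close> put at the position \<open>x\<close>. Mutations commute with translations along the
  belt line, so a walk between shapes makes sense at all positions at once and has a
  displacement.\<close>

definition located :: "real \<times> nat \<times> nat \<Rightarrow> real \<Rightarrow> seed" where
  "located p x = (case p of (\<sigma>, a, c) \<Rightarrow> node \<sigma> a c x)"

definition walk :: "real \<times> nat \<times> nat \<Rightarrow> real \<times> nat \<times> nat \<Rightarrow> nat \<Rightarrow> real \<Rightarrow> bool" where
  "walk p p' l t \<longleftrightarrow> (\<forall>x. (located p x, located p' (x + t)) \<in> M ^^ l)"

text \<open>Return walks are required to have the opposite displacement, so that a walk, a loop at its
  end and the walk back amount to the displacement of the loop.\<close>

definition linked :: "real \<times> nat \<times> nat \<Rightarrow> real \<times> nat \<times> nat \<Rightarrow> bool" where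
  "linked p p' \<longleftrightarrow> (\<exists>l t. walk p p' l t \<and> walk p' p l (- t))"

lemma walk_refl: "walk p p 0 0"
  by (simp add: walk_def)

lemma walk_trans:
  assumes "walk p p' l t" "walk p' p'' l' t'"
  shows "walk p p'' (l + l') (t + t')"
  unfolding walk_def
proof
  fix x
  have "(located p x, located p' (x + t)) \<in> M ^^ l" "(located p' (x + t), located p'' (x + t + t')) \<in> M ^^ l'"
    using assms unfolding walk_def by blast+
  then show "(located p x, located p'' (x + (t + t'))) \<in> M ^^ (l + l')"
    unfolding relpow_add add.assoc by (rule relcompI)
qed

lemma linked_refl: "linked p p"
  unfolding linked_def using walk_refl[of p] by (intro exI[of _ 0]) simp

lemma linked_sym:
  assumes "linked p p'"
  shows "linked p' p"
proof -
  obtain l t where "walk p p' l t" "walk p' p l (- t)" using assms unfolding linked_def by blast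
  then show ?thesis unfolding linked_def by (intro exI[of _ l] exI[of _ "- t"]) simp
qed

lemma linked_trans [trans]:
  assumes "linked p p'" "linked p' p''"
  shows "linked p p''"
proof -
  obtain l t l' t' where w: "walk p p' l t" "walk p' p l (- t)" "walk p' p'' l' t'" "walk p'' p' l' (- t')"
    using assms unfolding linked_def by blast
  have "walk p p'' (l + l') (t + t')" "walk p'' p (l + l') (- (t + t'))"
    using walk_trans[OF w(1,3)] walk_trans[OF w(4,2)] by (simp_all add: add.commute)
  then show ?thesis unfolding linked_def by blast
qed

lemma linked_step:
  assumes "\<And>x. (located p x, located p' (x + t)) \<in> M" "\<And>x. (located p' (x + t), located p x) \<in> M"
  shows "linked p p'"
proof -
  have "(located p' x, located p (x + - t)) \<in> M" for x
    using assms(2)[of "x - t"] by simp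
  then show ?thesis
    unfolding linked_def walk_def using assms(1) by (intro exI[of _ 1] exI[of _ t]) simp
qed

lemma linked_middle_le:
  assumes "\<sigma> \<in> {1, -1}" "1 \<le> a" "a \<le> c" "c \<le> n"
  shows "linked (\<sigma>, a, c) (\<sigma>, a, c - a)"
proof (rule linked_step)
  have \<sigma>: "\<sigma> * \<sigma> = 1" using assms(1) by auto
  fix x
  have m: "labelled_mutation pos 2 (belt_seed \<sigma> (ang a) (ang c) x)
      (relabel (Transposition.transpose 2 3) (belt_seed \<sigma> (ang a) (ang (c - a)) (x + 0)))"
    unfolding ang_diff[OF assms(3)] add_0_right
    by (rule mutate_middle_le[OF \<sigma>])
      (use assms in \<open>auto simp: ang_pos ang_le_iff simp del: less_divide_eq_numeral1 intro!: ang_less_half_pi_iff[THEN iffD2]\<close>)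
  show "(located (\<sigma>, a, c) x, located (\<sigma>, a, c - a) (x + 0)) \<in> M"
    "(located (\<sigma>, a, c - a) (x + 0), located (\<sigma>, a, c) x) \<in> M"
    unfolding located_def node_def prod.case using seed_mutation_both_ways[OF \<sigma> _ m] by simp_all
qed

lemma mutation_middle_gt:
  assumes "\<sigma> \<in> {1, -1}" "c < a" "a \<le> n"
  defines "t \<equiv> cos (ang c) / (sin (ang a) * sin (ang (a - c)))"
  shows "(located (\<sigma>, a, c) x, located (\<sigma>, a - c, c) (x + t)) \<in> M"
    "(located (\<sigma>, a - c, c) (x + t), located (\<sigma>, a, c) x) \<in> M"
proof -
  have \<sigma>: "\<sigma> * \<sigma> = 1" using assms(1) by auto
  have ca: "c \<le> a" using assms(2) by simp
  have "ang c < ang a" using ang_le_iff[of a c] assms(2) by linarith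
  moreover have "ang a < pi / 2" using assms(3) unfolding ang_less_half_pi_iff .
  ultimately have m: "labelled_mutation pos 2 (belt_seed \<sigma> (ang a) (ang c) x)
      (relabel (Transposition.transpose 1 2) (belt_seed \<sigma> (ang (a - c)) (ang c) (x + t)))"
    unfolding t_def ang_diff[OF ca] by (intro mutate_middle_gt[OF \<sigma>] ang_nonneg)
  show "(located (\<sigma>, a, c) x, located (\<sigma>, a - c, c) (x + t)) \<in> M"
    "(located (\<sigma>, a - c, c) (x + t), located (\<sigma>, a, c) x) \<in> M"
    unfolding located_def node_def prod.case using seed_mutation_both_ways[OF \<sigma> _ m] by simp_all
qed

lemma linked_rotate:
  assumes "\<sigma> \<in> {1, -1}" "a \<le> n" "c \<le> n" "a + c > n"
  shows "linked (\<sigma>, a, c) (- \<sigma>, q - a - c, a)"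
proof (rule linked_step)
  have \<sigma>: "\<sigma> * \<sigma> = 1" using assms(1) by auto
  have acq: "a + c \<le> q" using assms q by simp
  fix x
  let ?t = "- 1 + cot (ang a) * cot (ang (q - a - c))"
  have "ang a < pi / 2" "ang c < pi / 2" using assms(2,3) unfolding ang_less_half_pi_iff by simp_all
  moreover have "ang a + ang c > pi / 2"
    using ang_less_half_pi_iff[of "a + c"] ang_neq_half_pi[of "a + c"] assms(4) unfolding ang_add by linarith
  ultimately have "labelled_mutation pos 1 (belt_seed \<sigma> (ang a) (ang c) x)
      (relabel (Transposition.transpose 2 3 \<circ> Transposition.transpose 1 2)
        (belt_seed (- \<sigma>) (ang (q - a - c)) (ang a) (x - 1 + cot (ang a) * cot (ang (q - a - c)))))"
    unfolding ang_third[OF acq] by (intro mutate_source_acyclic[OF \<sigma>])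
  moreover have "x - 1 + k = x + (- 1 + k)" for k by simp
  ultimately have m: "labelled_mutation pos 1 (belt_seed \<sigma> (ang a) (ang c) x)
      (relabel (Transposition.transpose 2 3 \<circ> Transposition.transpose 1 2)
        (belt_seed (- \<sigma>) (ang (q - a - c)) (ang a) (x + ?t)))"
    by (simp only:)
  have b: "bij (Transposition.transpose 2 3 \<circ> Transposition.transpose 1 2 :: 3 \<Rightarrow> 3)"
    by (simp add: bij_comp)
  show "(located (\<sigma>, a, c) x, located (- \<sigma>, q - a - c, a) (x + ?t)) \<in> M"
    "(located (- \<sigma>, q - a - c, a) (x + ?t), located (\<sigma>, a, c) x) \<in> M"
    unfolding located_def node_def prod.case using seed_mutation_both_ways[OF \<sigma> b m] by simp_all
qed

text \<open>The subtractive Euclidean algorithm, carried out by mutations in the middle.\<close>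

lemma linked_gcd:
  assumes "\<sigma> \<in> {1, -1}" "1 \<le> a" "a \<le> n" "c \<le> n"
  shows "linked (\<sigma>, a, c) (\<sigma>, gcd a c, 0)"
  using assms(2-)
proof (induction "a + c" arbitrary: a c rule: less_induct)
  case less
  consider "c = 0" | "0 < c" "a \<le> c" | "0 < c" "c < a" by linarith
  then show ?case
  proof cases
    case 1
    then show ?thesis by (simp add: linked_refl)
  next
    case 2
    have "linked (\<sigma>, a, c - a) (\<sigma>, gcd a (c - a), 0)" using less 2 by (intro less.hyps) auto
    moreover have "gcd a (c - a) = gcd a c"
      using gcd_diff1_nat[of a c] 2 by (metis gcd.commute)
    ultimately show ?thesis
      using linked_trans[OF linked_middle_le[OF assms(1), of a c]] less.prems 2 by simp
  next
    case 3
    have "linked (\<sigma>, a, c) (\<sigma>, a - c, c)"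
      using mutation_middle_gt[OF assms(1) 3(2) less.prems(2)] by (rule linked_step)
    also have "linked (\<sigma>, a - c, c) (\<sigma>, gcd (a - c) c, 0)" using less 3 by (intro less.hyps) auto
    also have "gcd (a - c) c = gcd a c" using gcd_diff1_nat[of c a] 3 by simp
    finally show ?thesis .
  qed
qed

text \<open>Euclidean steps preserve the greatest common divisor, so it has to be changed by a rotation
  at an acyclic seed. Among the \<open>g\<close> consecutive numbers \<open>n + 1 - g, \<dots>, n\<close> there is one, \<open>c\<close>,
  congruent to \<open>q\<close> modulo \<open>g\<close>. Then \<open>(g, c)\<close> is coprime and acyclic, and it is rotated to \<open>(q - g
  - c, g)\<close>, whose greatest common divisor is \<open>g\<close>.\<close>

lemma linked_origin:
  assumes g: "1 \<le> g" "g \<le> n" "coprime g q"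
  shows "linked (1, 1, n) (- 1, g, 0)"
proof -
  define j where "j = (n + g) div g"
  define c where "c = q - g * j"
  have j1: "g * j \<le> n + g" by (simp add: j_def)
  have j2: "n < g * j"
  proof -
    have "n + g = g * j + (n + g) mod g"
      unfolding j_def by (rule mult_div_mod_eq[symmetric])
    moreover have "(n + g) mod g < g" using g(1) by simp
    ultimately show ?thesis by linarith
  qed
  have c: "c \<le> n" "g + c > n" "c + g * j = q" using j1 j2 g q by (auto simp: c_def)
  have "gcd g (j * g + c) = gcd g c" by (rule gcd_add_mult)
  moreover have "j * g + c = q" using c(3) by (simp add: mult.commute)
  ultimately have "gcd g c = gcd g q" by simp
  then have gc: "gcd g c = 1" using g(3) by (simp only: coprime_iff_gcd_eq_1)
  have j0: "j \<ge> 2"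
  proof (rule ccontr)
    assume "\<not> j \<ge> 2"
    then have "g * j \<le> g * 1" by (intro mult_left_mono) auto
    then show False using j2 g(2) by linarith
  qed
  have gj: "q - g - c = g * (j - 1)" using c(3) j0 by (simp add: right_diff_distrib' )
  have "linked (1, 1, n) (1, 1, 0)" using linked_gcd[of 1 1 n] n by simp
  also have "linked (1, 1, 0) (1, g, c)" using linked_gcd[of 1 g c] g c gc by (simp add: linked_sym)
  also have "linked (1, g, c) (- 1, q - g - c, g)" using linked_rotate[of 1 g c] g c by simp
  also have "linked (- 1, q - g - c, g) (- 1, gcd (q - g - c) g, 0)"
  proof (rule linked_gcd)
    show "1 \<le> q - g - c" using gj g(1) j0 by simp
    show "q - g - c \<le> n" using c(2) q by simp
  qed (use g in auto)
  also have "gcd (q - g - c) g = g" unfolding gj by simp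
  finally show ?thesis .
qed

definition \<beta> :: "nat \<Rightarrow> real" where
  "\<beta> a = 1 / (sin (ang a))\<^sup>2"

text \<open>At \<open>c = 0\<close> the Euclidean step \<open>(g, 0) \<mapsto> (g - 0, 0)\<close> leaves the shape unchanged.\<close>

lemma walk_loop:
  assumes "\<sigma> \<in> {1, -1}" "1 \<le> g" "g \<le> n"
  shows "walk (\<sigma>, g, 0) (\<sigma>, g, 0) N (real N * \<beta> g)"
proof (induction N)
  case 0
  then show ?case by (simp add: walk_refl)
next
  case (Suc N)
  have "walk (\<sigma>, g, 0) (\<sigma>, g, 0) 1 (\<beta> g)"
    unfolding walk_def
    using mutation_middle_gt(1)[of \<sigma> 0 g] assms by (simp add: \<beta>_def ang_def power2_eq_square)
  from walk_trans[OF Suc.IH this] show ?case by (simp add: algebra_simps)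
qed

text \<open>The walks consist of excursions from the initial shape, one for each \<open>g\<close>, with \<open>f g\<close> loops
  at \<open>(g, 0)\<close>. Independence of the translations makes their end points distinct.\<close>

lemma mutation_ball_lower:
  obtains L where "\<And>N. (N + 1) ^ half_phi \<le> card (mutation_ball (L + half_phi * N))"
proof -
  let ?H = "half_totatives q" and ?o = "(1, 1, n) :: real \<times> nat \<times> nat"
  have H: "1 \<le> a \<and> a \<le> n \<and> coprime a q" if "a \<in> ?H" for a
    using that q by (auto simp: half_totatives_def in_totatives_iff)
  have "\<exists>l. \<forall>N. walk ?o ?o (l + N) (real N * \<beta> g)" if g: "g \<in> ?H" for g
  proof -
    have "linked ?o (- 1, g, 0)" using linked_origin[of g] H[OF g] by simp
    then obtain l t where w: "walk ?o (- 1, g, 0) l t" "walk (- 1, g, 0) ?o l (- t)"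
      unfolding linked_def by blast
    have "walk ?o ?o (l + l + N) (real N * \<beta> g)" for N
    proof -
      have "walk (- 1, g, 0) (- 1, g, 0) N (real N * \<beta> g)" using walk_loop[of "- 1" g] H[OF g] by simp
      from walk_trans[OF walk_trans[OF w(1) this] w(2)] show ?thesis
        by (simp add: algebra_simps)
    qed
    then show ?thesis by blast
  qed
  then obtain l where l: "\<And>g N. g \<in> ?H \<Longrightarrow> walk ?o ?o (l g + N) (real N * \<beta> g)" by metis
  have combine: "walk ?o ?o (\<Sum>g\<in>A. l g + f g) (\<Sum>g\<in>A. real (f g) * \<beta> g)"
    if "A \<subseteq> ?H" for A and f :: "nat \<Rightarrow> nat"
    using finite_subset[OF that finite_half_totatives] that
  proof (induction A rule: finite_induct)
    case empty
    then show ?case by (simp add: walk_refl)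
  next
    case (insert g A)
    then have "walk ?o ?o (\<Sum>g\<in>A. l g + f g) (\<Sum>g\<in>A. real (f g) * \<beta> g)"
      "walk ?o ?o (l g + f g) (real (f g) * \<beta> g)" using l by auto
    then have "walk ?o ?o ((l g + f g) + (\<Sum>g\<in>A. l g + f g)) (real (f g) * \<beta> g + (\<Sum>g\<in>A. real (f g) * \<beta> g))"
      using walk_trans by blast
    then show ?case using insert.hyps by simp
  qed
  \<comment> \<open>The total length of the excursions without their loops.\<close>
  define L where "L = (\<Sum>g\<in>?H. l g)"
  have "(N + 1) ^ half_phi \<le> card (mutation_ball (L + half_phi * N))" for N
  proof -
    define place where "place f = node 1 1 n (\<Sum>g\<in>?H. real (f g) * \<beta> g)" for f :: "nat \<Rightarrow> nat"
    let ?F = "?H \<rightarrow>\<^sub>E {..N}"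
    have "place ` ?F \<subseteq> mutation_ball (L + half_phi * N)"
    proof (rule image_subsetI)
      fix f assume f: "f \<in> ?F"
      have "(\<Sum>g\<in>?H. l g + f g) \<le> (\<Sum>g\<in>?H. l g + N)"
        by (rule sum_mono) (use f in \<open>auto dest: PiE_mem\<close>)
      also have "\<dots> = L + half_phi * N" by (simp add: L_def sum.distrib)
      finally have "(\<Sum>g\<in>?H. l g + f g) \<le> L + half_phi * N" .
      moreover have "(origin, place f) \<in> M ^^ (\<Sum>g\<in>?H. l g + f g)"
      proof -
        have "(located ?o 0, located ?o (0 + (\<Sum>g\<in>?H. real (f g) * \<beta> g))) \<in> M ^^ (\<Sum>g\<in>?H. l g + f g)"
          using combine[OF subset_refl, of f] unfolding walk_def by blast
        then show ?thesis by (simp only: located_def place_def prod.case add_0)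
      qed
      ultimately show "place f \<in> mutation_ball (L + half_phi * N)"
        unfolding mutation_ball_def by blast
    qed
    then have "card (place ` ?F) \<le> card (mutation_ball (L + half_phi * N))"
      by (rule card_mono[OF mutation_ball_upper(1)])
    moreover have "inj_on place ?F"
    proof (rule inj_onI)
      fix f f' assume f: "f \<in> ?F" "f' \<in> ?F" "place f = place f'"
      have "(\<Sum>g\<in>?H. real (f g) * \<beta> g) = (\<Sum>g\<in>?H. real (f' g) * \<beta> g)"
      proof (rule belt_seed_inj)
        show "0 < ang 1" "0 \<le> ang n" by (simp_all add: ang_pos ang_nonneg)
        show "ang 1 < pi / 2" "ang n < pi / 2" using n unfolding ang_less_half_pi_iff by simp_all
        show "seed_of (belt_seed 1 (ang 1) (ang n) (\<Sum>g\<in>?H. real (f g) * \<beta> g))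
            = seed_of (belt_seed 1 (ang 1) (ang n) (\<Sum>g\<in>?H. real (f' g) * \<beta> g))"
          using f(3) by (simp only: place_def node_def)
      qed simp
      then have "(\<Sum>g\<in>?H. of_int (int (f g) - int (f' g)) / (sin (pi * real g / real q))\<^sup>2) = 0"
        by (simp add: \<beta>_def ang_def sum_subtractf diff_divide_distrib)
      then have "int (f g) - int (f' g) = 0" if "g \<in> ?H" for g
        by (rule inverse_sin_squared_independent[OF n q _ that])
      then show "f = f'" using f(1,2) by (intro PiE_ext) auto
    qed
    ultimately have "card ?F \<le> card (mutation_ball (L + half_phi * N))"
      by (simp only: card_image)
    then show ?thesis by (simp add: card_PiE)
  qed
  then show ?thesis using that by blast
qed

theorem belt_seed_growth:
  "polynomial_growth (exchange_growth pos (belt_seed 1 (ang 1) (ang n) 0))"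
  "polynomial_growth_rate (exchange_growth pos (belt_seed 1 (ang 1) (ang n) 0)) = half_phi"
proof -
  have eq: "exchange_growth pos (belt_seed 1 (ang 1) (ang n) 0) = (\<lambda>m. card (mutation_ball m))"
    by (rule ext) (rule exchange_growth_eq_card_ball)
  obtain L where L: "\<And>N. (N + 1) ^ half_phi \<le> card (mutation_ball (L + half_phi * N))"
    using mutation_ball_lower by blast
  show "polynomial_growth (exchange_growth pos (belt_seed 1 (ang 1) (ang n) 0))"
    "polynomial_growth_rate (exchange_growth pos (belt_seed 1 (ang 1) (ang n) 0)) = half_phi"
    unfolding eq by (rule growth_rate_eqI[OF mutation_ball_upper(2) L])+
qed

end


section \<open>Growth of the exchange graph of the initial triangle\<close>

theorem corollary6p13:
  fixes n :: nat and X Y Z F G :: "real ^ 2" and x0 :: labelled_seed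
  assumes "n \<ge> 1"
    and "initial_triangle n X Y Z"
    and "initial_seed X Y Z x0"
    and "altitude_foot Z X Y F"
    and "altitude_foot X Y Z G"
  shows "polynomial_growth (exchange_growth (positive_wrt F G) x0) \<and>
         real (polynomial_growth_rate (exchange_growth (positive_wrt F G) x0))
           = real (totient (2 * n + 1)) / 2"
proof -
  obtain e d \<kappa> h where belt: "belt e d \<kappa> h" and G: "G = F + h *\<^sub>R e"
    and x0: "x0 = belt.belt_seed F e d \<kappa> 1 (pi / real (2 * n + 1)) (real n * (pi / real (2 * n + 1))) 0"
    using initial_seed_belt_seed[OF assms] .
  interpret belt F e d \<kappa> h by (rule belt)
  interpret odd_belt F e d \<kappa> h n "2 * n + 1"
    by unfold_locales (use assms(1) in auto)
  have x0': "x0 = belt_seed 1 (ang 1) (ang n) 0"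
    unfolding x0 ang_def by (simp add: mult.commute)
  have "2 * card (half_totatives (2 * n + 1)) = totient (2 * n + 1)"
    by (rule card_half_totatives) (use assms(1) in simp)
  then have "real (card (half_totatives (2 * n + 1))) = real (totient (2 * n + 1)) / 2"
    by linarith
  then show ?thesis
    unfolding x0' G by (intro conjI belt_seed_growth(1)) (simp only: belt_seed_growth(2))
qed

end
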